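(* Let $R$ be a finite non-trivial unital ring, $V$ a finite left $R$-module, $n$ a positive integer, $G$ a subgroup of the symmetric group of degree $n$ such that $|G|$ is a unit in $R$, and $\theta=\frac1{|G|}\sum_{g\in G}g\in R[G]$. Let $(R,M,\psi,\Phi)$ be a form ring and let $\rho_G=(\theta(V^n),(\rho_G)_M,(\rho_G)_\Phi,\beta)$ be a $G$-representation of $(R,M,\psi,\Phi)$. If $C\subset V^n$ is a $G$-code that is both $G$-self-dual and $G$-isotropic with respect to $\rho_G$, then the $G$-full weight enumerator $\mathrm{fwe}_G(\theta C)$ is invariant under the action of the Clifford--Weil group $\mathcal{C}(\rho_G)$ on $\mathbb{C}[\theta(V^n)]$.
   Context: **Codes.** $G$ acts on $V^n$ by $g\cdot v=(v_{g^{-1}(1)},\dots,v_{g^{-1}(n)})$, making $V^n$ a left $R[G]$-module. A $G$-code is an $R[G]$-submodule $C\subset V^n$; $\theta C=\{\theta u\mid u\in C\}$. Let $\alpha_1,\dots,\alpha_t$ be representatives of the $G$-orbits on $\{1,\dots,n\}$. The elements of $\theta(V^n)$ are exactly the vectors of $V^n$ constant on each orbit, and $u\mapsto u_G=(u_{\alpha_1},\dots,u_{\alpha_t})$ is an $R$-module isomorphism $\theta(V^n)\to V^t$. $\mathbb{C}[\theta(V^n)]$ is the complex vector space with basis $(e_u)_{u\in\theta(V^n)}$, and $\mathrm{fwe}_G(\theta C)=\sum_{u\in\theta C}e_u$. **Forms.** All tensor products are over $\mathbb{Z}$. $\mathrm{Bil}(V,\mathbb{Q}/\mathbb{Z})$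 is the group of homomorphisms $b\colon V\otimes V\to\mathbb{Q}/\mathbb{Z}$. For such $b$ put $b^n_G(u\otimes v)=\sum_{i=1}^t b(u_{\alpha_i}\otimes v_{\alpha_i})$ for $u,v\in\theta(V^n)$, and let $\mathrm{Bil}(\theta(V^n),\mathbb{Q}/\mathbb{Z})_G$ be the set of all $b^n_G$; it is a right $(R\otimes R)$-module by $b(r\otimes s)(x\otimes y)=b(rx\otimes sy)$. A quadratic map is $\phi\colon V\to\mathbb{Q}/\mathbb{Z}$ with $\phi(u+v+w)+\phi(u)+\phi(v)+\phi(w)=\phi(u+v)+\phi(v+w)+\phi(w+u)+\phi(0)$ for all $u,v,w\in V$. For such $\phi$ put $\phi^n_G(u)=\sum_{i=1}^t\phi(u_{\alpha_i})$ for $u\in\theta(V^n)$, and let $\mathrm{Quad}_0(\theta(V^n),\mathbb{Q}/\mathbb{Z})_G$ be the set of all such maps $\phi^n_G$ with value $0$ at $0$; $R$ acts on it by $q[r](u)=q(ru)$. **Form rings** (in the sense of Nebe, Rains and Sloane). A twisted $R$-module is a right $(R\otimes R)$-module $M$ with an additive automorphism $\tau$ such that $\tau^2=\mathrm{id}_M$ and $\tau(m(r\otimes s))=\tau(m)(s\otimes r)$. An $R$-qmodule is an abelian group $\Phi$ with a map $R\to\mathrm{End}_{\mathbb{Z}}(\Phi)$, written $\phi\mapsto\phi[r]$, such that $\phi[1]=\phi$, $\phi[r][s]=\phi[rs]$ and $\phi[r+s+t]+\phi[r]+\phi[s]+\phi[t]=\phi[r+s]+\phi[s+t]+\phi[t+r]+\phi[0]$.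 A twisted $R$-module is an $R$-qmodule by $m[r]=m(r\otimes r)$. A quadratic pair $(M,\Phi)$ on $R$ consists of a twisted $R$-module $M$, an $R$-qmodule $\Phi$, and $R$-qmodule homomorphisms (additive maps commuting with all $[r]$) $\{\!\{\cdot\}\!\}\colon M\to\Phi$ and $\lambda\colon\Phi\to M$ such that, for all $m\in M,\phi\in\Phi,r,s\in R$: $\{\!\{\tau(m)\}\!\}=\{\!\{m\}\!\}$, $\tau(\lambda(\phi))=\lambda(\phi)$, $\lambda(\{\!\{m\}\!\})=m+\tau(m)$, and $\phi[r+s]-\phi[r]-\phi[s]=\{\!\{\lambda(\phi)(r\otimes s)\}\!\}$. A twisted ring $(R,M,\psi)$ is a twisted $R$-module $M$ with an additive isomorphism $\psi\colon R\to M$ satisfying $\psi(rs)=\psi(r)(1\otimes s)$ and such that $\psi^{-1}(\tau(\psi(1)))$ is a unit of $R$. For $r\in R$ put $r^J=\psi^{-1}(\psi(1)(r\otimes1))$. A form ring $(R,M,\psi,\Phi)$ is a twisted ring $(R,M,\psi)$ together with a quadratic pair $(M,\Phi)$ on $R$. **$G$-representations.** A $G$-representation $\rho_G=(\theta(V^n),(\rho_G)_M,(\rho_G)_\Phi,\beta)$ of $(R,M,\psi,\Phi)$ consists of a right $(R\otimes R)$-module homomorphism $(\rho_G)_M\colon M\to\mathrm{Bil}(\theta(V^n),\mathbb{Q}/\mathbb{Z})_G$ with $(\rho_G)_M(\tau(m))(u\otimes v)=(\rho_G)_M(m)(v\otimes u)$, and an $R$-qmodule homomorphism $(\rho_G)_\Phi\colon\Phi\to\mathrm{Quad}_0(\theta(V^n),\mathbb{Q}/\mathbb{Z})_G$,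 such that $(\rho_G)_\Phi(\{\!\{m\}\!\})(u)=(\rho_G)_M(m)(u\otimes u)$ and $(\rho_G)_M(\lambda(\phi))(u\otimes v)=(\rho_G)_\Phi(\phi)(u+v)-(\rho_G)_\Phi(\phi)(u)-(\rho_G)_\Phi(\phi)(v)$, and such that $\beta=(\rho_G)_M(\psi(1))$ is a nondegenerate bilinear form on $\theta(V^n)$. **Self-dual isotropic codes.** A $G$-code $C$ is $G$-self-dual with respect to $\rho_G$ if $\theta C=\{v\in\theta(V^n)\mid\beta(v\otimes u)=0\text{ for all }u\in\theta C\}$ (equivalently, $\theta C$ is the set of $v\in\theta(V^n)$ with $(\rho_G)_M(m)(v\otimes u)=0$ for all $m\in M$, $u\in\theta C$). It is $G$-isotropic with respect to $\rho_G$ if $(\rho_G)_M(m)(v\otimes u)=0$ for all $m\in M$, $u,v\in\theta C$, and $(\rho_G)_\Phi(\phi)(u)=0$ for all $\phi\in\Phi$, $u\in\theta C$. **Clifford--Weil group.** For $r\in R^*$ and $\phi\in\Phi$ define $m_r(e_u)=e_{ru}$ and $d_\phi(e_u)=\exp(2\pi\sqrt{-1}\,(\rho_G)_\Phi(\phi)(u))\,e_u$. A symmetric idempotent is $\iota\in R$ with $\iota^2=\iota$ and $\iota R\cong\iota^JR$ as right $R$-modules; then there exist $\mu_\iota\in\iota R\iota^J$ and $\nu_\iota\in\iota^JR\iota$ with $\iota=\mu_\iota\nu_\iota$. For each such $(\iota,\mu_\iota,\nu_\iota)$ define \[ h_{\iota,\mu_\iota,\nu_\iota}(e_u)=|\iota(\theta(V^n))|^{-1/2}\sum_{v\in\iota(\theta(V^n))}\exp\bigl(2\pi\sqrt{-1}\,\beta(v\otimes\nu_\iota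 u)\bigr)\,e_{(1-\iota)u+v}. \] $\mathcal{C}(\rho_G)$ is the subgroup of $\mathrm{GL}(\mathbb{C}[\theta(V^n)])$ generated by all $m_r$, $d_\phi$ and $h_{\iota,\mu_\iota,\nu_\iota}$ ($r\in R^*$, $\phi\in\Phi$, $\iota=\mu_\iota\nu_\iota$ a symmetric idempotent). *)

theory Defs
  imports
    Complex_Main
    "HOL-Analysis.Finite_Cartesian_Product"
    "HOL-Algebra.Bij"
    "HOL-Algebra.Generated_Groups"
begin

text \<open>
  Tensor products over the integers are rendered through their universal property: a homomorphism
  out of \<open>A \<otimes> B\<close> is a map of two arguments that is additive in each of them, and a right module
  over \<open>R \<otimes> R\<close> is an abelian group with an action \<open>act m r s\<close> (read \<open>m(r \<otimes> s)\<close>) that is additive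
  in each of its three arguments, unital, and compatible with
  \<open>(r \<otimes> s)(r' \<otimes> s') = rr' \<otimes> ss'\<close>.
  Throughout, \<open>V\<^sup>n\<close> is the type \<open>'v ^ 'n\<close>, so \<open>n = CARD('n)\<close> is an arbitrary positive integer and
  the type \<open>'n\<close> plays the role of \<open>{1,\<dots>,n}\<close>.
\<close>

section \<open>The group of rationals modulo integers\<close>

quotient_type qz = rat / "\<lambda>x y :: rat. x - y \<in> \<int>"
proof (rule equivpI)
  show "reflp (\<lambda>x y :: rat. x - y \<in> \<int>)"
    by (simp add: reflp_def)
  show "symp (\<lambda>x y :: rat. x - y \<in> \<int>)"
    by (metis (mono_tags, lifting) Ints_minus minus_diff_eq sympI)
  show "transp (\<lambda>x y :: rat. x - y \<in> \<int>)"
    by (rule transpI) (metis Ints_add diff_add_cancel add_diff_eq)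
qed

instantiation qz :: ab_group_add
begin

lift_definition zero_qz :: qz is 0 .

lift_definition plus_qz :: "qz \<Rightarrow> qz \<Rightarrow> qz" is "(+)"
  by (metis Ints_add add_diff_add)

lift_definition uminus_qz :: "qz \<Rightarrow> qz" is uminus
  by (metis Ints_minus minus_diff_minus)

lift_definition minus_qz :: "qz \<Rightarrow> qz \<Rightarrow> qz" is "(-)"
  by (metis Ints_diff diff_diff_eq diff_diff_eq2 add.commute diff_add_eq)

instance
  by standard (transfer; simp add: algebra_simps)+

end

text \<open>The character sending the class of \<open>q\<close> to \<open>exp(2\<pi>iq)\<close>.\<close>

lift_definition qz_exp :: "qz \<Rightarrow> complex" is
  "\<lambda>q. exp (2 * complex_of_real pi * \<i> * of_rat q)"
proof -
  fix x y :: rat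
  assume "x - y \<in> \<int>"
  then obtain k where "x = y + of_int k"
    by (metis Ints_cases add.commute diff_add_cancel)
  then have "exp (2 * complex_of_real pi * \<i> * of_rat x)
      = exp (2 * complex_of_real pi * \<i> * of_rat y) * cis (2 * pi * of_int k)"
    by (simp add: of_rat_add cis_conv_exp exp_add[symmetric] algebra_simps)
  then show "exp (2 * complex_of_real pi * \<i> * of_rat x) = exp (2 * complex_of_real pi * \<i> * of_rat y)"
    by (simp add: cis_multiple_2pi)
qed


section \<open>Rings, modules and the group ring action\<close>

definition ring_unit :: "'r::ring_1 \<Rightarrow> bool" where
  "ring_unit r \<longleftrightarrow> (\<exists>s. r * s = 1 \<and> s * r = 1)"

definition ring_inverse :: "'r::ring_1 \<Rightarrow> 'r" where
  "ring_inverse r = (THE s. r * s = 1 \<and> s * r = 1)"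

locale left_module =
  fixes act :: "'r::ring_1 \<Rightarrow> 'v::ab_group_add \<Rightarrow> 'v"
  assumes act_add_right: "act r (x + y) = act r x + act r y"
    and act_add_left: "act (r + s) x = act r x + act s x"
    and act_act: "act r (act s x) = act (r * s) x"
    and act_one: "act 1 x = x"

definition vec_act :: "('r \<Rightarrow> 'v \<Rightarrow> 'v) \<Rightarrow> 'r \<Rightarrow> 'v ^ 'n \<Rightarrow> 'v ^ 'n" where
  "vec_act act r v = (\<chi> i. act r (v $ i))"

definition perm_act :: "('n \<Rightarrow> 'n) \<Rightarrow> 'v ^ 'n \<Rightarrow> 'v ^ 'n" where
  "perm_act g v = (\<chi> i. v $ (inv_into UNIV g i))"

text \<open>An element \<open>\<Sum>\<^sub>g a\<^sub>g g\<close> of \<open>R[G]\<close> is given by its coefficient function \<open>a\<close>; only the values of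
  \<open>a\<close> on \<open>G\<close> matter.\<close>

definition group_ring_act ::
    "('r \<Rightarrow> 'v \<Rightarrow> 'v) \<Rightarrow> ('n \<Rightarrow> 'n) set \<Rightarrow> (('n \<Rightarrow> 'n) \<Rightarrow> 'r) \<Rightarrow> 'v::ab_group_add ^ 'n \<Rightarrow> 'v ^ 'n" where
  "group_ring_act act G a v = (\<Sum>g\<in>G. vec_act act (a g) (perm_act g v))"

definition theta :: "('n \<Rightarrow> 'n) set \<Rightarrow> ('n \<Rightarrow> 'n) \<Rightarrow> 'r::ring_1" where
  "theta G = (\<lambda>g. if g \<in> G then ring_inverse (of_nat (card G)) else 0)"

definition theta_image ::
    "('r::ring_1 \<Rightarrow> 'v::ab_group_add \<Rightarrow> 'v) \<Rightarrow> ('n \<Rightarrow> 'n) set \<Rightarrow> ('v ^ 'n) set \<Rightarrow> ('v ^ 'n) set" where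
  "theta_image act G C = group_ring_act act G (theta G) ` C"

abbreviation theta_space ::
    "('r::ring_1 \<Rightarrow> 'v::ab_group_add \<Rightarrow> 'v) \<Rightarrow> ('n \<Rightarrow> 'n) set \<Rightarrow> ('v ^ 'n) set" where
  "theta_space act G \<equiv> theta_image act G UNIV"

definition G_code ::
    "('r::ring_1 \<Rightarrow> 'v::ab_group_add \<Rightarrow> 'v) \<Rightarrow> ('n \<Rightarrow> 'n) set \<Rightarrow> ('v ^ 'n) set \<Rightarrow> bool" where
  "G_code act G C \<longleftrightarrow>
     0 \<in> C \<and> (\<forall>u\<in>C. \<forall>v\<in>C. u + v \<in> C) \<and> (\<forall>u\<in>C. - u \<in> C) \<and>
     (\<forall>a. \<forall>u\<in>C. group_ring_act act G a u \<in> C)"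

definition orbit_representatives :: "('n \<Rightarrow> 'n) set \<Rightarrow> 'n set \<Rightarrow> bool" where
  "orbit_representatives G A \<longleftrightarrow> (\<forall>i. \<exists>!a. a \<in> A \<and> a \<in> {g i | g. g \<in> G})"


section \<open>Bilinear forms and quadratic maps\<close>

definition Bil :: "('v::ab_group_add \<Rightarrow> 'v \<Rightarrow> qz) set" where
  "Bil = {b. (\<forall>x. additive (\<lambda>y. b x y)) \<and> (\<forall>y. additive (\<lambda>x. b x y))}"

definition quadratic_map :: "('v::ab_group_add \<Rightarrow> qz) \<Rightarrow> bool" where
  "quadratic_map \<phi> \<longleftrightarrow>
     (\<forall>u v w. \<phi> (u + v + w) + \<phi> u + \<phi> v + \<phi> w = \<phi> (u + v) + \<phi> (v + w) + \<phi> (w + u) + \<phi> 0)"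

text \<open>Maps defined on \<open>\<theta>(V\<^sup>n)\<close> are extended by \<open>0\<close> outside; this makes their encoding as total
  functions unique. The set \<open>A\<close> is the set of chosen orbit representatives.\<close>

definition bil_G :: "('r::ring_1 \<Rightarrow> 'v::ab_group_add \<Rightarrow> 'v) \<Rightarrow> ('n \<Rightarrow> 'n) set \<Rightarrow> 'n set
    \<Rightarrow> ('v \<Rightarrow> 'v \<Rightarrow> qz) \<Rightarrow> 'v ^ 'n \<Rightarrow> 'v ^ 'n \<Rightarrow> qz" where
  "bil_G act G A b u v =
     (if u \<in> theta_space act G \<and> v \<in> theta_space act G then \<Sum>i\<in>A. b (u $ i) (v $ i) else 0)"

definition Bil_G :: "('r::ring_1 \<Rightarrow> 'v::ab_group_add \<Rightarrow> 'v) \<Rightarrow> ('n \<Rightarrow> 'n) set \<Rightarrow> 'n set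
    \<Rightarrow> ('v ^ 'n \<Rightarrow> 'v ^ 'n \<Rightarrow> qz) set" where
  "Bil_G act G A = bil_G act G A ` Bil"

definition quad_G :: "('r::ring_1 \<Rightarrow> 'v::ab_group_add \<Rightarrow> 'v) \<Rightarrow> ('n \<Rightarrow> 'n) set \<Rightarrow> 'n set
    \<Rightarrow> ('v \<Rightarrow> qz) \<Rightarrow> 'v ^ 'n \<Rightarrow> qz" where
  "quad_G act G A \<phi> u = (if u \<in> theta_space act G then \<Sum>i\<in>A. \<phi> (u $ i) else 0)"

definition Quad0_G :: "('r::ring_1 \<Rightarrow> 'v::ab_group_add \<Rightarrow> 'v) \<Rightarrow> ('n \<Rightarrow> 'n) set \<Rightarrow> 'n set
    \<Rightarrow> ('v ^ 'n \<Rightarrow> qz) set" where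
  "Quad0_G act G A = {quad_G act G A \<phi> | \<phi>. quadratic_map \<phi> \<and> quad_G act G A \<phi> 0 = 0}"

definition nondegenerate_on :: "'w::zero set \<Rightarrow> ('w \<Rightarrow> 'w \<Rightarrow> qz) \<Rightarrow> bool" where
  "nondegenerate_on W \<beta> \<longleftrightarrow>
     (\<forall>u\<in>W. (\<forall>v\<in>W. \<beta> u v = 0) \<longrightarrow> u = 0) \<and> (\<forall>v\<in>W. (\<forall>u\<in>W. \<beta> u v = 0) \<longrightarrow> v = 0)"


section \<open>Form rings\<close>

text \<open>Here \<open>mact m r s\<close> stands for \<open>m(r \<otimes> s)\<close> and \<open>qact \<phi> r\<close> for \<open>\<phi>[r]\<close>.\<close>

locale right_tensor_module =
  fixes mact :: "'m::ab_group_add \<Rightarrow> 'r::ring_1 \<Rightarrow> 'r \<Rightarrow> 'm"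
  assumes mact_additive: "additive (\<lambda>m. mact m r s)"
    and mact_additive_left: "additive (\<lambda>r. mact m r s)"
    and mact_additive_right: "additive (\<lambda>s. mact m r s)"
    and mact_one: "mact m 1 1 = m"
    and mact_mact: "mact (mact m r s) r' s' = mact m (r * r') (s * s')"

locale twisted_module = right_tensor_module mact
  for mact :: "'m::ab_group_add \<Rightarrow> 'r::ring_1 \<Rightarrow> 'r \<Rightarrow> 'm" +
  fixes \<tau> :: "'m \<Rightarrow> 'm"
  assumes \<tau>_additive: "additive \<tau>"
    and \<tau>_bij: "bij \<tau>"
    and \<tau>_\<tau>: "\<tau> (\<tau> m) = m"
    and \<tau>_mact: "\<tau> (mact m r s) = mact (\<tau> m) s r"

locale qmodule =
  fixes qact :: "'f::ab_group_add \<Rightarrow> 'r::ring_1 \<Rightarrow> 'f"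
  assumes qact_additive: "additive (\<lambda>\<phi>. qact \<phi> r)"
    and qact_one: "qact \<phi> 1 = \<phi>"
    and qact_qact: "qact (qact \<phi> r) s = qact \<phi> (r * s)"
    and qact_quadratic: "qact \<phi> (r + s + t) + qact \<phi> r + qact \<phi> s + qact \<phi> t
      = qact \<phi> (r + s) + qact \<phi> (s + t) + qact \<phi> (t + r) + qact \<phi> 0"

definition qmodule_hom ::
    "('a::ab_group_add \<Rightarrow> 'r \<Rightarrow> 'a) \<Rightarrow> ('b::ab_group_add \<Rightarrow> 'r \<Rightarrow> 'b) \<Rightarrow> ('a \<Rightarrow> 'b) \<Rightarrow> bool" where
  "qmodule_hom qa qb f \<longleftrightarrow> additive f \<and> (\<forall>x r. f (qa x r) = qb (f x) r)"

text \<open>\<open>br m\<close> stands for the class \<open>{{m}}\<close>.\<close>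

locale quadratic_pair = twisted_module mact \<tau> + qmodule qact
  for mact :: "'m::ab_group_add \<Rightarrow> 'r::ring_1 \<Rightarrow> 'r \<Rightarrow> 'm"
    and \<tau> :: "'m \<Rightarrow> 'm"
    and qact :: "'f::ab_group_add \<Rightarrow> 'r \<Rightarrow> 'f" +
  fixes br :: "'m \<Rightarrow> 'f" and lam :: "'f \<Rightarrow> 'm"
  assumes br_hom: "qmodule_hom (\<lambda>m r. mact m r r) qact br"
    and lam_hom: "qmodule_hom qact (\<lambda>m r. mact m r r) lam"
    and br_\<tau>: "br (\<tau> m) = br m"
    and \<tau>_lam: "\<tau> (lam \<phi>) = lam \<phi>"
    and lam_br: "lam (br m) = m + \<tau> m"
    and qact_add: "qact \<phi> (r + s) - qact \<phi> r - qact \<phi> s = br (mact (lam \<phi>) r s)"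

locale twisted_ring = twisted_module mact \<tau>
  for mact :: "'m::ab_group_add \<Rightarrow> 'r::ring_1 \<Rightarrow> 'r \<Rightarrow> 'm"
    and \<tau> :: "'m \<Rightarrow> 'm" +
  fixes \<psi> :: "'r \<Rightarrow> 'm"
  assumes \<psi>_additive: "additive \<psi>"
    and \<psi>_bij: "bij \<psi>"
    and \<psi>_mult: "\<psi> (r * s) = mact (\<psi> r) 1 s"
    and \<psi>_unit: "ring_unit (inv_into UNIV \<psi> (\<tau> (\<psi> 1)))"

locale form_ring = twisted_ring mact \<tau> \<psi> + quadratic_pair mact \<tau> qact br lam
  for mact :: "'m::ab_group_add \<Rightarrow> 'r::ring_1 \<Rightarrow> 'r \<Rightarrow> 'm"
    and \<tau> :: "'m \<Rightarrow> 'm"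
    and \<psi> :: "'r \<Rightarrow> 'm"
    and qact :: "'f::ab_group_add \<Rightarrow> 'r \<Rightarrow> 'f"
    and br :: "'m \<Rightarrow> 'f"
    and lam :: "'f \<Rightarrow> 'm"

definition J_map :: "('m \<Rightarrow> 'r::ring_1 \<Rightarrow> 'r \<Rightarrow> 'm) \<Rightarrow> ('r \<Rightarrow> 'm) \<Rightarrow> 'r \<Rightarrow> 'r" where
  "J_map mact \<psi> r = inv_into UNIV \<psi> (mact (\<psi> 1) r 1)"

definition right_ideals_isomorphic :: "'r::ring_1 \<Rightarrow> 'r \<Rightarrow> bool" where
  "right_ideals_isomorphic a b \<longleftrightarrow>
     (\<exists>f. bij_betw f (range (\<lambda>r. a * r)) (range (\<lambda>r. b * r)) \<and>
        (\<forall>x \<in> range (\<lambda>r. a * r). \<forall>y \<in> range (\<lambda>r. a * r). f (x + y) = f x + f y) \<and>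
        (\<forall>x \<in> range (\<lambda>r. a * r). \<forall>r. f (x * r) = f x * r))"

definition symmetric_idempotent ::
    "('m \<Rightarrow> 'r::ring_1 \<Rightarrow> 'r \<Rightarrow> 'm) \<Rightarrow> ('r \<Rightarrow> 'm) \<Rightarrow> 'r \<Rightarrow> bool" where
  "symmetric_idempotent mact \<psi> \<iota> \<longleftrightarrow>
     \<iota> * \<iota> = \<iota> \<and> right_ideals_isomorphic \<iota> (J_map mact \<psi> \<iota>)"

definition symmetric_idempotent_factorization ::
    "('m \<Rightarrow> 'r::ring_1 \<Rightarrow> 'r \<Rightarrow> 'm) \<Rightarrow> ('r \<Rightarrow> 'm) \<Rightarrow> 'r \<Rightarrow> 'r \<Rightarrow> 'r \<Rightarrow> bool" where
  "symmetric_idempotent_factorization mact \<psi> \<iota> \<mu> \<nu> \<longleftrightarrow>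
     symmetric_idempotent mact \<psi> \<iota> \<and>
     \<mu> \<in> range (\<lambda>r. \<iota> * r * J_map mact \<psi> \<iota>) \<and>
     \<nu> \<in> range (\<lambda>r. J_map mact \<psi> \<iota> * r * \<iota>) \<and>
     \<iota> = \<mu> * \<nu>"


section \<open>Representations and codes\<close>

definition G_representation ::
    "('r::ring_1 \<Rightarrow> 'v::ab_group_add \<Rightarrow> 'v) \<Rightarrow> ('n \<Rightarrow> 'n) set \<Rightarrow> 'n set
     \<Rightarrow> ('m::ab_group_add \<Rightarrow> 'r \<Rightarrow> 'r \<Rightarrow> 'm) \<Rightarrow> ('m \<Rightarrow> 'm) \<Rightarrow> ('r \<Rightarrow> 'm)
     \<Rightarrow> ('f::ab_group_add \<Rightarrow> 'r \<Rightarrow> 'f) \<Rightarrow> ('m \<Rightarrow> 'f) \<Rightarrow> ('f \<Rightarrow> 'm)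
     \<Rightarrow> ('m \<Rightarrow> 'v ^ 'n \<Rightarrow> 'v ^ 'n \<Rightarrow> qz) \<Rightarrow> ('f \<Rightarrow> 'v ^ 'n \<Rightarrow> qz)
     \<Rightarrow> ('v ^ 'n \<Rightarrow> 'v ^ 'n \<Rightarrow> qz) \<Rightarrow> bool" where
  "G_representation act G A mact \<tau> \<psi> qact br lam \<rho>M \<rho>\<Phi> \<beta> \<longleftrightarrow>
     (let W = theta_space act G in
       (\<forall>m. \<rho>M m \<in> Bil_G act G A) \<and>
       (\<forall>m m'. \<forall>u\<in>W. \<forall>v\<in>W. \<rho>M (m + m') u v = \<rho>M m u v + \<rho>M m' u v) \<and>
       (\<forall>m r s. \<forall>u\<in>W. \<forall>v\<in>W. \<rho>M (mact m r s) u v = \<rho>M m (vec_act act r u) (vec_act act s v)) \<and>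
       (\<forall>m. \<forall>u\<in>W. \<forall>v\<in>W. \<rho>M (\<tau> m) u v = \<rho>M m v u) \<and>
       (\<forall>\<phi>. \<rho>\<Phi> \<phi> \<in> Quad0_G act G A) \<and>
       (\<forall>\<phi> \<phi>'. \<forall>u\<in>W. \<rho>\<Phi> (\<phi> + \<phi>') u = \<rho>\<Phi> \<phi> u + \<rho>\<Phi> \<phi>' u) \<and>
       (\<forall>\<phi> r. \<forall>u\<in>W. \<rho>\<Phi> (qact \<phi> r) u = \<rho>\<Phi> \<phi> (vec_act act r u)) \<and>
       (\<forall>m. \<forall>u\<in>W. \<rho>\<Phi> (br m) u = \<rho>M m u u) \<and>
       (\<forall>\<phi>. \<forall>u\<in>W. \<forall>v\<in>W. \<rho>M (lam \<phi>) u v = \<rho>\<Phi> \<phi> (u + v) - \<rho>\<Phi> \<phi> u - \<rho>\<Phi> \<phi> v) \<and>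
       \<beta> = \<rho>M (\<psi> 1) \<and> nondegenerate_on W \<beta>)"

definition G_self_dual :: "('r::ring_1 \<Rightarrow> 'v::ab_group_add \<Rightarrow> 'v) \<Rightarrow> ('n \<Rightarrow> 'n) set
    \<Rightarrow> ('v ^ 'n \<Rightarrow> 'v ^ 'n \<Rightarrow> qz) \<Rightarrow> ('v ^ 'n) set \<Rightarrow> bool" where
  "G_self_dual act G \<beta> C \<longleftrightarrow>
     theta_image act G C = {v \<in> theta_space act G. \<forall>u \<in> theta_image act G C. \<beta> v u = 0}"

definition G_isotropic :: "('r::ring_1 \<Rightarrow> 'v::ab_group_add \<Rightarrow> 'v) \<Rightarrow> ('n \<Rightarrow> 'n) set
    \<Rightarrow> ('m \<Rightarrow> 'v ^ 'n \<Rightarrow> 'v ^ 'n \<Rightarrow> qz) \<Rightarrow> ('f \<Rightarrow> 'v ^ 'n \<Rightarrow> qz) \<Rightarrow> ('v ^ 'n) set \<Rightarrow> bool" where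
  "G_isotropic act G \<rho>M \<rho>\<Phi> C \<longleftrightarrow>
     (\<forall>m. \<forall>u \<in> theta_image act G C. \<forall>v \<in> theta_image act G C. \<rho>M m v u = 0) \<and>
     (\<forall>\<phi>. \<forall>u \<in> theta_image act G C. \<rho>\<Phi> \<phi> u = 0)"


section \<open>The Clifford-Weil group\<close>

text \<open>For a finite set \<open>W\<close>, the complex vector space with basis \<open>(e\<^sub>u)\<close>, \<open>u \<in> W\<close>, consists of the
  complex functions vanishing outside \<open>W\<close>, with \<open>e\<^sub>u\<close> the indicator function of \<open>u\<close>.\<close>

definition basis_space :: "'w set \<Rightarrow> ('w \<Rightarrow> complex) set" where
  "basis_space W = {f. \<forall>w. w \<notin> W \<longrightarrow> f w = 0}"

definition basis_vec :: "'w \<Rightarrow> 'w \<Rightarrow> complex" where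
  "basis_vec u = (\<lambda>w. if w = u then 1 else 0)"

text \<open>Invertible operators are, as in \<^const>\<open>BijGroup\<close>, extensional bijections, i.e.
  \<^const>\<open>undefined\<close> outside the space.\<close>

definition GL :: "'w set \<Rightarrow> (('w \<Rightarrow> complex) \<Rightarrow> 'w \<Rightarrow> complex) monoid" where
  "GL W = (BijGroup (basis_space W)) \<lparr>carrier :=
     {T \<in> carrier (BijGroup (basis_space W)).
        (\<forall>f \<in> basis_space W. \<forall>g \<in> basis_space W. T (\<lambda>w. f w + g w) = (\<lambda>w. T f w + T g w)) \<and>
        (\<forall>c. \<forall>f \<in> basis_space W. T (\<lambda>w. c * f w) = (\<lambda>w. c * T f w))}\<rparr>"

text \<open>The linear operator with \<open>e\<^sub>u \<mapsto> E u\<close> for \<open>u \<in> W\<close>.\<close>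

definition linear_extension ::
    "'w set \<Rightarrow> ('w \<Rightarrow> 'w \<Rightarrow> complex) \<Rightarrow> ('w \<Rightarrow> complex) \<Rightarrow> 'w \<Rightarrow> complex" where
  "linear_extension W E = (\<lambda>f \<in> basis_space W. \<lambda>w. \<Sum>u\<in>W. f u * E u w)"

definition op_m :: "('r::ring_1 \<Rightarrow> 'v::ab_group_add \<Rightarrow> 'v) \<Rightarrow> ('n \<Rightarrow> 'n) set \<Rightarrow> 'r
    \<Rightarrow> ('v ^ 'n \<Rightarrow> complex) \<Rightarrow> 'v ^ 'n \<Rightarrow> complex" where
  "op_m act G r = linear_extension (theta_space act G) (\<lambda>u. basis_vec (vec_act act r u))"

definition op_d :: "('r::ring_1 \<Rightarrow> 'v::ab_group_add \<Rightarrow> 'v) \<Rightarrow> ('n \<Rightarrow> 'n) set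
    \<Rightarrow> ('f \<Rightarrow> 'v ^ 'n \<Rightarrow> qz) \<Rightarrow> 'f \<Rightarrow> ('v ^ 'n \<Rightarrow> complex) \<Rightarrow> 'v ^ 'n \<Rightarrow> complex" where
  "op_d act G \<rho>\<Phi> \<phi> =
     linear_extension (theta_space act G) (\<lambda>u w. qz_exp (\<rho>\<Phi> \<phi> u) * basis_vec u w)"

definition op_h :: "('r::ring_1 \<Rightarrow> 'v::ab_group_add \<Rightarrow> 'v) \<Rightarrow> ('n \<Rightarrow> 'n) set
    \<Rightarrow> ('v ^ 'n \<Rightarrow> 'v ^ 'n \<Rightarrow> qz) \<Rightarrow> 'r \<Rightarrow> 'r
    \<Rightarrow> ('v ^ 'n \<Rightarrow> complex) \<Rightarrow> 'v ^ 'n \<Rightarrow> complex" where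
  "op_h act G \<beta> \<iota> \<nu> =
     (let W = theta_space act G; I = vec_act act \<iota> ` W in
       linear_extension W (\<lambda>u w. complex_of_real (real (card I) powr (- 1 / 2)) *
         (\<Sum>v\<in>I. qz_exp (\<beta> v (vec_act act \<nu> u)) * basis_vec (vec_act act (1 - \<iota>) u + v) w)))"

definition Clifford_Weil_group ::
    "('r::ring_1 \<Rightarrow> 'v::ab_group_add \<Rightarrow> 'v) \<Rightarrow> ('n \<Rightarrow> 'n) set
     \<Rightarrow> ('m \<Rightarrow> 'r \<Rightarrow> 'r \<Rightarrow> 'm) \<Rightarrow> ('r \<Rightarrow> 'm)
     \<Rightarrow> ('f \<Rightarrow> 'v ^ 'n \<Rightarrow> qz) \<Rightarrow> ('v ^ 'n \<Rightarrow> 'v ^ 'n \<Rightarrow> qz)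
     \<Rightarrow> (('v ^ 'n \<Rightarrow> complex) \<Rightarrow> 'v ^ 'n \<Rightarrow> complex) set" where
  "Clifford_Weil_group act G mact \<psi> \<rho>\<Phi> \<beta> =
     generate (GL (theta_space act G))
       ({op_m act G r | r. ring_unit r} \<union>
        {op_d act G \<rho>\<Phi> \<phi> | \<phi>. True} \<union>
        {op_h act G \<beta> \<iota> \<nu> | \<iota> \<mu> \<nu>. symmetric_idempotent_factorization mact \<psi> \<iota> \<mu> \<nu>})"

definition full_weight_enumerator :: "'w set \<Rightarrow> 'w \<Rightarrow> complex" where
  "full_weight_enumerator D = (\<lambda>w. \<Sum>u\<in>D. basis_vec u w)"

end

theory Submission
  imports Defs "HOL-Analysis.Complex_Transcendental"
begin

text \<open>
  On \<open>W = \<theta>(V\<^sup>n)\<close> the operator \<open>h\<^sub>\<iota>\<close> is a partial Fourier transform: it fixes the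
  component in \<open>(1 - \<iota>)W\<close> and transforms the component in \<open>\<iota>W\<close> with respect to the pairing
  \<open>(v, w) \<mapsto> \<beta>(v, \<nu>w)\<close>. This pairing is nondegenerate on \<open>\<iota>W\<close> because \<open>\<beta>\<close> is and
  \<open>\<mu>\<nu> = \<iota>\<close>, \<open>\<nu>\<mu> = \<iota>\<^sup>J\<close>; the second equation holds because left multiplication by \<open>\<nu>\<close>
  embeds \<open>\<iota>R\<close> into the equally large finite set \<open>\<iota>\<^sup>JR\<close>. A self-dual \<open>D = \<theta>C\<close> splits as
  \<open>(1 - \<iota>)D \<oplus> \<iota>D\<close> with \<open>\<iota>D\<close> equal to its own orthogonal complement in \<open>\<iota>W\<close>, so that
  \<open>|\<iota>D|\<^sup>2 = |\<iota>W|\<close> and the Fourier transform fixes the indicator function of \<open>\<iota>D\<close>.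
  The operators \<open>m\<^sub>r\<close> permute \<open>D\<close>, and the operators \<open>d\<^sub>\<phi>\<close> are trivial on \<open>D\<close> by isotropy.
\<close>

section \<open>Character sums\<close>

lemma qz_exp_zero [simp]: "qz_exp 0 = 1"
  by transfer simp

lemma qz_exp_add: "qz_exp (x + y) = qz_exp x * qz_exp y"
  by transfer (simp add: of_rat_add distrib_left exp_add)

text \<open>The character is faithful. This lets a nonzero value of a homomorphism into
  \<open>qz\<close> produce a factor different from 1 in a character sum.\<close>

lemma qz_exp_eq_1_iff: "qz_exp x = 1 \<longleftrightarrow> x = 0"
proof
  show "qz_exp x = 1 \<Longrightarrow> x = 0"
  proof transfer
    fix q :: rat
    assume "exp (2 * complex_of_real pi * \<i> * of_rat q) = 1"
    then obtain k :: int where "Im (2 * complex_of_real pi * \<i> * of_rat q) = of_int (2 * k) * pi"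
      by (auto simp: exp_eq_1)
    \<comment> \<open>Since \<open>of_rat q\<close> is real, the imaginary part above is
      \<open>2 * pi * of_rat q\<close>, which forces \<open>q = k\<close>.\<close>
    moreover have "(of_rat q :: complex) = of_real (of_rat q)"
      by (cases q) (simp add: of_rat_rat)
    ultimately have "(of_rat q :: real) = of_rat (of_int k)"
      by simp
    then show "q - 0 \<in> \<int>"
      by (simp only: of_rat_eq_iff) simp
  qed
qed simp

lemma qz_exp_diff: "qz_exp (x - y) = qz_exp x * qz_exp (- y)"
  using qz_exp_add[of x "- y"] by simp

lemma qz_exp_mult_minus [simp]: "qz_exp x * qz_exp (- x) = 1" "qz_exp (- x) * qz_exp x = 1"
  by (simp_all flip: qz_exp_add)

text \<open>Orthogonality of characters: translation by some \<open>a\<close> with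
  \<open>f a \<noteq> 0\<close> permutes \<open>I\<close> but multiplies the sum by
  \<open>qz_exp (f a)\<close>, which is not 1. Closure under addition is enough, because an
  injective self-map of a finite set is onto.\<close>

lemma sum_qz_exp:
  fixes f :: "'w::ab_group_add \<Rightarrow> qz"
  assumes "finite I"
    and add: "\<And>x y. x \<in> I \<Longrightarrow> y \<in> I \<Longrightarrow> x + y \<in> I"
    and f: "\<And>x y. x \<in> I \<Longrightarrow> y \<in> I \<Longrightarrow> f (x + y) = f x + f y"
  shows "(\<Sum>x\<in>I. qz_exp (f x)) = (if \<forall>x\<in>I. f x = 0 then of_nat (card I) else 0)"
proof (cases "\<forall>x\<in>I. f x = 0")
  case False
  then obtain a where a: "a \<in> I" "f a \<noteq> 0"
    by blast
  have "(+) a ` I = I"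
    by (rule card_subset_eq) (use assms(1) a(1) add in \<open>auto simp: card_image\<close>)
  then have "(\<Sum>x\<in>I. qz_exp (f x)) = (\<Sum>x\<in>(+) a ` I. qz_exp (f x))"
    by simp
  also have "\<dots> = (\<Sum>x\<in>I. qz_exp (f (a + x)))"
    by (simp add: sum.reindex)
  also have "\<dots> = qz_exp (f a) * (\<Sum>x\<in>I. qz_exp (f x))"
    by (simp add: f[OF a(1)] qz_exp_add sum_distrib_left)
  finally have "(\<Sum>x\<in>I. qz_exp (f x)) = 0"
    using a(2) by (simp add: qz_exp_eq_1_iff)
  with False show ?thesis
    by auto
qed simp


section \<open>Invertible operators on a space with a finite basis\<close>

text \<open>Row \<open>u\<close> of the matrix \<open>E\<close> holds the coefficients of the image
  of the basis vector at \<open>u\<close>. Applying \<open>E\<close> and then \<open>E'\<close>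
  therefore belongs to the matrix product \<open>E E'\<close>, which \<open>inv\<close> takes to be
  the identity.\<close>

lemma linear_extension_inverse:
  assumes "finite W"
    and E: "\<And>u w. u \<in> W \<Longrightarrow> w \<notin> W \<Longrightarrow> E u w = 0"
    and inv: "\<And>u x. u \<in> W \<Longrightarrow> x \<in> W \<Longrightarrow>
      (\<Sum>w\<in>W. E u w * E' w x) = (if u = x then 1 else 0)"
    and E': "\<And>u w. u \<in> W \<Longrightarrow> w \<notin> W \<Longrightarrow> E' u w = 0"
    and f: "f \<in> basis_space W"
  shows "linear_extension W E' (linear_extension W E f) = f"
proof
  fix x
  have Ef: "linear_extension W E f \<in> basis_space W"
    using f E by (auto simp: linear_extension_def basis_space_def)
  have eq: "linear_extension W E' (linear_extension W E f) x
      = (\<Sum>w\<in>W. (\<Sum>u\<in>W. f u * E u w) * E' w x)"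
    using f Ef by (simp add: linear_extension_def)
  show "linear_extension W E' (linear_extension W E f) x = f x"
  proof (cases "x \<in> W")
    case True
    have "(\<Sum>w\<in>W. (\<Sum>u\<in>W. f u * E u w) * E' w x) = (\<Sum>w\<in>W. \<Sum>u\<in>W. f u * (E u w * E' w x))"
      by (simp add: sum_distrib_right mult.assoc)
    also have "\<dots> = (\<Sum>u\<in>W. \<Sum>w\<in>W. f u * (E u w * E' w x))"
      by (rule sum.swap)
    also have "\<dots> = (\<Sum>u\<in>W. f u * (if u = x then 1 else 0))"
      by (rule sum.cong) (simp_all add: inv True flip: sum_distrib_left)
    also have "\<dots> = f x"
      using True assms(1) by (simp add: if_distrib cong: if_cong)
    finally show ?thesis
      using eq by simp
  next
    case False
    with eq E' f show ?thesis
      by (simp add: basis_space_def)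
  qed
qed

lemma linear_extension_in_GL:
  assumes "finite W"
    and E: "\<And>u w. u \<in> W \<Longrightarrow> w \<notin> W \<Longrightarrow> E u w = 0"
    and E': "\<And>u w. u \<in> W \<Longrightarrow> w \<notin> W \<Longrightarrow> E' u w = 0"
    and inv: "\<And>u x. u \<in> W \<Longrightarrow> x \<in> W \<Longrightarrow>
      (\<Sum>w\<in>W. E u w * E' w x) = (if u = x then 1 else 0)"
    and inv': "\<And>u x. u \<in> W \<Longrightarrow> x \<in> W \<Longrightarrow>
      (\<Sum>w\<in>W. E' u w * E w x) = (if u = x then 1 else 0)"
  shows "linear_extension W E \<in> carrier (GL W)"
proof -
  have space: "linear_extension W F f \<in> basis_space W"
    if "\<And>u w. u \<in> W \<Longrightarrow> w \<notin> W \<Longrightarrow> F u w = 0" "f \<in> basis_space W" for F f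
    using that by (auto simp: linear_extension_def basis_space_def)
  have "bij_betw (linear_extension W E) (basis_space W) (basis_space W)"
    by (rule bij_betw_byWitness[where f' = "linear_extension W E'"])
      (use linear_extension_inverse[of W E E'] linear_extension_inverse[of W E' E] assms space
        in auto)
  moreover have "linear_extension W E \<in> extensional (basis_space W)"
    by (simp add: linear_extension_def)
  ultimately have "linear_extension W E \<in> carrier (BijGroup (basis_space W))"
    by (simp add: BijGroup_def Bij_def)
  moreover have "(\<lambda>w. f w + g w) \<in> basis_space W" "(\<lambda>w. c * f w) \<in> basis_space W"
    if "f \<in> basis_space W" "g \<in> basis_space W" for f g c
    using that by (auto simp: basis_space_def)
  ultimately show ?thesis
    by (auto simp: GL_def linear_extension_def sum.distrib distrib_right mult.assoc sum_distrib_left)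
qed

text \<open>\<open>GL W\<close> is \<open>BijGroup\<close> with a smaller carrier, so it suffices
  that the linear bijections form a subgroup.\<close>

lemma group_GL: "group (GL W)"
proof -
  let ?S = "basis_space W" and ?B = "BijGroup (basis_space W)"
  interpret B: group ?B
    by (rule group_BijGroup)
  have add: "(\<lambda>w. f w + g w) \<in> ?S" and scale: "(\<lambda>w. c * f w) \<in> ?S"
    if "f \<in> ?S" "g \<in> ?S" for f g c
    using that by (auto simp: basis_space_def)
  have "subgroup (carrier (GL W)) ?B"
  proof
    show "carrier (GL W) \<subseteq> carrier ?B"
      by (auto simp: GL_def)
    show "\<one>\<^bsub>?B\<^esub> \<in> carrier (GL W)"
      using B.one_closed add scale by (auto simp: GL_def BijGroup_def)
    fix x
    assume x: "x \<in> carrier (GL W)"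
    then have xB: "x \<in> Bij ?S"
      by (auto simp: GL_def BijGroup_def)
    then have x_S: "x f \<in> ?S" if "f \<in> ?S" for f
      using that Bij_imp_funcset by blast
    have x_add: "x (\<lambda>w. f w + g w) = (\<lambda>w. x f w + x g w)" if "f \<in> ?S" "g \<in> ?S" for f g
      using x that by (auto simp: GL_def)
    have x_scale: "x (\<lambda>w. c * f w) = (\<lambda>w. c * x f w)" if "f \<in> ?S" for f c
      using x that by (auto simp: GL_def)
    show "x \<otimes>\<^bsub>?B\<^esub> y \<in> carrier (GL W)" if y: "y \<in> carrier (GL W)" for y
    proof -
      have yB: "y \<in> Bij ?S"
        using y by (auto simp: GL_def BijGroup_def)
      then have y_S: "y f \<in> ?S" if "f \<in> ?S" for f
        using that Bij_imp_funcset by blast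
      have y_add: "y (\<lambda>w. f w + g w) = (\<lambda>w. y f w + y g w)" if "f \<in> ?S" "g \<in> ?S" for f g
        using y that by (auto simp: GL_def)
      have y_scale: "y (\<lambda>w. c * f w) = (\<lambda>w. c * y f w)" if "f \<in> ?S" for f c
        using y that by (auto simp: GL_def)
      have "compose ?S x y \<in> Bij ?S"
        using xB yB by (rule compose_Bij)
      with xB yB show ?thesis
        by (auto simp: GL_def BijGroup_def compose_def add scale x_S y_S x_add y_add x_scale y_scale)
    qed
    define z where "z = inv_into ?S x"
    have bij: "bij_betw x ?S ?S"
      using xB by (simp add: Bij_def)
    have z_S: "z f \<in> ?S" and xz: "x (z f) = f" if "f \<in> ?S" for f
      using bij that unfolding z_def
      by (auto simp: bij_betw_def inv_into_into f_inv_into_f)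
    have zx: "z (x f) = f" if "f \<in> ?S" for f
      using bij that unfolding z_def by (auto simp: bij_betw_def)
    \<comment> \<open>Linearity passes to the inverse: \<open>x\<close> sends the sum of
      \<open>z f\<close> and \<open>z g\<close> to the sum of \<open>f\<close> and \<open>g\<close>,
      and \<open>z\<close> undoes \<open>x\<close>.\<close>
    have z_add: "z (\<lambda>w. f w + g w) = (\<lambda>w. z f w + z g w)" if "f \<in> ?S" "g \<in> ?S" for f g
      using zx[of "\<lambda>w. z f w + z g w"] that by (simp add: x_add z_S xz add)
    have z_scale: "z (\<lambda>w. c * f w) = (\<lambda>w. c * z f w)" if "f \<in> ?S" for f c
      using zx[of "\<lambda>w. c * z f w"] that by (simp add: x_scale z_S xz scale)
    have "inv\<^bsub>?B\<^esub> x = restrict z ?S"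
      using xB by (simp add: inv_BijGroup z_def)
    moreover have "inv\<^bsub>?B\<^esub> x \<in> carrier ?B"
      using x by (auto simp: GL_def intro: B.inv_closed)
    ultimately show "inv\<^bsub>?B\<^esub> x \<in> carrier (GL W)"
      by (auto simp: GL_def add scale z_add z_scale)
  qed
  then show ?thesis
    using subgroup.subgroup_is_group[OF _ B.is_group] by (fastforce simp: GL_def)
qed

text \<open>The stabiliser of \<open>f\<close> is closed under the operations that build the
  generated group. For an inverse, apply \<open>inv h\<close> to \<open>h f = f\<close>.\<close>

lemma generate_GL_fixes:
  assumes "H \<subseteq> carrier (GL W)"
    and f: "f \<in> basis_space W"
    and H: "\<And>T. T \<in> H \<Longrightarrow> T f = f"
    and "T \<in> generate (GL W) H"
  shows "T f = f"
proof -
  interpret group "GL W"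
    by (rule group_GL)
  have mult: "(S \<otimes>\<^bsub>GL W\<^esub> T) f = S (T f)" if "S \<in> carrier (GL W)" "T \<in> carrier (GL W)" for S T
    using that f by (auto simp: GL_def BijGroup_def compose_def)
  have one: "\<one>\<^bsub>GL W\<^esub> f = f"
    using f by (simp add: GL_def BijGroup_def)
  from assms(4) show ?thesis
  proof induction
    case one
    show ?case by (fact \<open>\<one>\<^bsub>GL W\<^esub> f = f\<close>)
  next
    case (incl h)
    then show ?case by (rule H)
  next
    case (inv h)
    then have h: "h \<in> carrier (GL W)"
      using assms(1) by blast
    show ?case
      using mult[OF inv_closed[OF h] h] H[OF inv] one l_inv[OF h] by simp
  next
    case (eng h1 h2)
    then show ?case
      using mult generate_in_carrier[OF assms(1)] by metis
  qed
qed

lemma full_weight_enumerator_eq: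
  "finite D \<Longrightarrow> full_weight_enumerator D = (\<lambda>w. if w \<in> D then 1 else 0)"
  by (simp add: full_weight_enumerator_def basis_vec_def)

lemma linear_extension_full_weight_enumerator:
  assumes "finite W" "D \<subseteq> W"
  shows "linear_extension W E (full_weight_enumerator D) = (\<lambda>w. \<Sum>u\<in>D. E u w)"
proof -
  have D: "finite D"
    using assms finite_subset by blast
  have "full_weight_enumerator D \<in> basis_space W"
    using assms(2) by (auto simp: full_weight_enumerator_eq[OF D] basis_space_def)
  moreover have "(\<Sum>u\<in>W. (if u \<in> D then 1 else 0) * E u w) = (\<Sum>u\<in>D. E u w)" for w
    by (rule sum.mono_neutral_cong_right) (use assms in auto)
  ultimately show ?thesis
    by (simp add: linear_extension_def full_weight_enumerator_eq[OF D])
qed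


section \<open>Submodules\<close>

context left_module
begin

lemma act_zero_right [simp]: "act r 0 = 0"
  using act_add_right[of r 0 0] by simp

lemma act_zero_left [simp]: "act 0 x = 0"
  using act_add_left[of 0 0 x] by simp

lemma act_minus_left: "act (- r) x = - act r x"
  using act_add_left[of r "- r" x] by (simp add: eq_neg_iff_add_eq_0 add.commute)

lemma act_minus_right: "act r (- x) = - act r x"
  using act_add_right[of r x "- x"] by (simp add: eq_neg_iff_add_eq_0 add.commute)

lemma act_diff_left: "act (r - s) x = act r x - act s x"
  using act_add_left[of r "- s" x] by (simp add: act_minus_left)

lemma act_diff_right: "act r (x - y) = act r x - act r y"
  using act_add_right[of r x "- y"] by (simp add: act_minus_right)

lemma act_sum: "act r (sum f S) = (\<Sum>x\<in>S. act r (f x))"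
  by (induction S rule: infinite_finite_induct) (simp_all add: act_add_right)

text \<open>Closure under negation comes from the action of \<open>- 1\<close>; see
  \<open>submodule_minus\<close>.\<close>

definition is_submodule :: "'v set \<Rightarrow> bool" where
  "is_submodule W \<longleftrightarrow> 0 \<in> W \<and> (\<forall>u\<in>W. \<forall>v\<in>W. u + v \<in> W) \<and> (\<forall>r. \<forall>u\<in>W. act r u \<in> W)"

lemma submodule_zero: "is_submodule W \<Longrightarrow> 0 \<in> W"
  and submodule_add: "is_submodule W \<Longrightarrow> u \<in> W \<Longrightarrow> v \<in> W \<Longrightarrow> u + v \<in> W"
  and submodule_act: "is_submodule W \<Longrightarrow> u \<in> W \<Longrightarrow> act r u \<in> W"
  by (auto simp: is_submodule_def)

lemma submodule_minus: "is_submodule W \<Longrightarrow> u \<in> W \<Longrightarrow> - u \<in> W"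
  using submodule_act[of W u "- 1"] by (simp add: act_minus_left act_one)

lemma submodule_diff: "is_submodule W \<Longrightarrow> u \<in> W \<Longrightarrow> v \<in> W \<Longrightarrow> u - v \<in> W"
  using submodule_add[of W u "- v"] submodule_minus[of W v] by simp

end

lemma left_module_vec_act:
  assumes "left_module act"
  shows "left_module (vec_act act :: 'r::ring_1 \<Rightarrow> 'v::ab_group_add ^ 'n \<Rightarrow> 'v ^ 'n)"
proof -
  interpret left_module act by fact
  show ?thesis
    by unfold_locales
      (simp_all add: vec_act_def vec_eq_iff act_add_right act_add_left act_act act_one)
qed


section \<open>Multiplication operators\<close>

lemma act_unit_bij_betw:
  assumes "left_module act" "left_module.is_submodule act D" "ring_unit r"
  shows "bij_betw (act r) D D"
proof -
  interpret left_module act by fact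
  obtain s where "r * s = 1" "s * r = 1"
    using assms(3) by (auto simp: ring_unit_def)
  then show ?thesis
    by (intro bij_betw_byWitness[where f' = "act s"])
      (use submodule_act[OF assms(2)] in \<open>auto simp: act_act act_one\<close>)
qed

lemma multiplication_in_GL:
  assumes "left_module act" "left_module.is_submodule act W" "finite W" "ring_unit r"
  shows "linear_extension W (\<lambda>u. basis_vec (act r u)) \<in> carrier (GL W)"
proof -
  interpret left_module act by fact
  obtain s where s: "r * s = 1" "s * r = 1"
    using assms(4) by (auto simp: ring_unit_def)
  note W = submodule_act[OF assms(2)]
  \<comment> \<open>The names \<open>r\<close> and \<open>s\<close> are bound afresh, so that one
    computation yields both orders of the matrix product.\<close>
  have eq: "(\<Sum>w\<in>W. basis_vec (act r u) w * basis_vec (act s w) x) = (if u = x then 1 else 0)"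
    if "u \<in> W" "r * s = 1" "s * r = 1" for u x r s
  proof -
    have "(\<Sum>w\<in>W. basis_vec (act r u) w * basis_vec (act s w) x)
        = (\<Sum>w\<in>W. if w = act r u then basis_vec (act s w) x else 0)"
      by (rule sum.cong) (simp_all add: basis_vec_def)
    also have "\<dots> = basis_vec (act s (act r u)) x"
      using W[OF that(1)] assms(3) by simp
    finally show ?thesis
      using that by (auto simp: act_act act_one basis_vec_def)
  qed
  show ?thesis
    by (rule linear_extension_in_GL[where E' = "\<lambda>u. basis_vec (act s u)"])
      (use eq s W assms(3) in \<open>auto simp: basis_vec_def\<close>)
qed

text \<open>A unit permutes the submodule \<open>D\<close>, so its operator only reorders the sum of
  basis vectors.\<close>

lemma multiplication_fixes:
  assumes "left_module act" "left_module.is_submodule act D" "finite W" "D \<subseteq> W" "ring_unit r"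
  shows "linear_extension W (\<lambda>u. basis_vec (act r u)) (full_weight_enumerator D)
    = full_weight_enumerator D"
  using sum.reindex_bij_betw[OF act_unit_bij_betw[OF assms(1,2,5)], of "\<lambda>u. basis_vec u w" for w]
  by (simp add: linear_extension_full_weight_enumerator[OF assms(3,4)])
    (simp add: full_weight_enumerator_def)


section \<open>Diagonal operators\<close>

lemma diagonal_in_GL:
  assumes "finite W"
  shows "linear_extension W (\<lambda>u w. qz_exp (q u) * basis_vec u w) \<in> carrier (GL W)"
proof -
  \<comment> \<open>Two independent exponents are allowed, so that \<open>q\<close> and its negative
    can be inserted in either order.\<close>
  have eq: "(\<Sum>w\<in>W. qz_exp (q u) * basis_vec u w * (qz_exp (p w) * basis_vec w x))
      = (if u = x then qz_exp (q u) * qz_exp (p u) else 0)"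
    if "u \<in> W" for u x and p q :: "'a \<Rightarrow> qz"
  proof -
    have "(\<Sum>w\<in>W. qz_exp (q u) * basis_vec u w * (qz_exp (p w) * basis_vec w x))
      = (\<Sum>w\<in>W. if w = u then qz_exp (q u) * (qz_exp (p w) * basis_vec w x) else 0)"
      by (rule sum.cong) (simp_all add: basis_vec_def)
    with that assms show ?thesis
      by (simp add: basis_vec_def)
  qed
  have "basis_vec u w = 0" if "u \<in> W" "w \<notin> W" for u w
    using that by (auto simp: basis_vec_def)
  then show ?thesis
    by (intro linear_extension_in_GL[where E' = "\<lambda>u w. qz_exp (- q u) * basis_vec u w"])
      (simp_all add: assms eq[of _ q "\<lambda>w. - q w"] eq[of _ "\<lambda>w. - q w" q])
qed

lemma diagonal_fixes:
  assumes "finite W" "D \<subseteq> W" "\<And>u. u \<in> D \<Longrightarrow> q u = 0"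
  shows "linear_extension W (\<lambda>u w. qz_exp (q u) * basis_vec u w) (full_weight_enumerator D)
    = full_weight_enumerator D"
  using assms(3)
  by (simp add: linear_extension_full_weight_enumerator[OF assms(1,2)])
    (simp add: full_weight_enumerator_def)


section \<open>Partial Fourier transforms\<close>

text \<open>This isolates what \<open>h\<close> requires of the representation.
  \<open>\<iota>J\<close> stands for \<open>\<iota>\<close> under the map J and enters as the
  adjoint of \<open>\<iota>\<close>; \<open>\<nu>\<mu>\<close> is discharged later by
  \<open>factorization_commute\<close>. Additivity is assumed on \<open>W\<close> alone, since forms
  are encoded as zero outside it.\<close>

locale partial_fourier = left_module act
  for act :: "'r::ring_1 \<Rightarrow> 'w::ab_group_add \<Rightarrow> 'w" +
  fixes W :: "'w set" and \<beta> :: "'w \<Rightarrow> 'w \<Rightarrow> qz" and \<iota> \<iota>J \<mu> \<nu> :: 'r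
  assumes finite_W: "finite W"
    and submodule_W: "is_submodule W"
    and add_left: "u \<in> W \<Longrightarrow> v \<in> W \<Longrightarrow> w \<in> W \<Longrightarrow> \<beta> (u + v) w = \<beta> u w + \<beta> v w"
    and add_right: "u \<in> W \<Longrightarrow> v \<in> W \<Longrightarrow> w \<in> W \<Longrightarrow> \<beta> u (v + w) = \<beta> u v + \<beta> u w"
    and nondegenerate: "nondegenerate_on W \<beta>"
    and adjoint: "u \<in> W \<Longrightarrow> v \<in> W \<Longrightarrow> \<beta> (act \<iota> u) v = \<beta> u (act \<iota>J v)"
    and idem: "\<iota> * \<iota> = \<iota>"
    and \<mu>\<nu>: "\<mu> * \<nu> = \<iota>"
    and \<nu>\<mu>: "\<nu> * \<mu> = \<iota>J"
    and \<nu>_\<iota>: "\<nu> * \<iota> = \<nu>"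
    and \<iota>J_\<nu>: "\<iota>J * \<nu> = \<nu>"
begin

abbreviation I :: "'w set" where "I \<equiv> act \<iota> ` W"

definition pair :: "'w \<Rightarrow> 'w \<Rightarrow> qz" where "pair v w = \<beta> v (act \<nu> w)"

definition scale :: complex where "scale = of_real (real (card I) powr (- 1 / 2))"

lemmas zero_W = submodule_zero[OF submodule_W]
lemmas add_W = submodule_add[OF submodule_W]
lemmas diff_W = submodule_diff[OF submodule_W]
lemmas act_W [simp] = submodule_act[OF submodule_W]

lemma I_iff: "v \<in> I \<longleftrightarrow> v \<in> W \<and> act \<iota> v = v"
proof
  assume "v \<in> I"
  then show "v \<in> W \<and> act \<iota> v = v"
    by (auto simp: act_act idem)
next
  assume "v \<in> W \<and> act \<iota> v = v"
  then show "v \<in> I"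
    by (metis imageI)
qed

lemma finite_I: "finite I"
  using finite_W by simp

lemma add_I: "u \<in> I \<Longrightarrow> v \<in> I \<Longrightarrow> u + v \<in> I"
  by (simp add: I_iff add_W act_add_right)

lemma scale_sq: "scale * scale * of_nat (card I) = 1"
proof -
  have "card I > 0"
    using finite_I zero_W by (auto simp: card_gt_0_iff)
  then have "real (card I) powr (- 1 / 2) * real (card I) powr (- 1 / 2) * real (card I) = 1"
    by (simp add: powr_minus powr_half_sqrt field_simps)
  then show ?thesis
    unfolding scale_def by (metis of_real_1 of_real_mult of_real_of_nat_eq)
qed

section \<open>Bilinearity and nondegeneracy of the pairing on \<open>I\<close>\<close>

lemma pair_add_left: "u \<in> W \<Longrightarrow> v \<in> W \<Longrightarrow> w \<in> W \<Longrightarrow> pair (u + v) w = pair u w + pair v w"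
  by (simp add: pair_def add_left)

lemma pair_add_right: "u \<in> W \<Longrightarrow> v \<in> W \<Longrightarrow> w \<in> W \<Longrightarrow> pair u (v + w) = pair u v + pair u w"
  by (simp add: pair_def add_right act_add_right)

lemma pair_diff_left: "u \<in> W \<Longrightarrow> v \<in> W \<Longrightarrow> w \<in> W \<Longrightarrow> pair (u - v) w = pair u w - pair v w"
  using pair_add_left[of "u - v" v w] by (simp add: diff_W eq_diff_eq)

lemma pair_diff_right: "u \<in> W \<Longrightarrow> v \<in> W \<Longrightarrow> w \<in> W \<Longrightarrow> pair u (v - w) = pair u v - pair u w"
  using pair_add_right[of u "v - w" w] by (simp add: diff_W eq_diff_eq)

lemma pair_act_left: "u \<in> W \<Longrightarrow> v \<in> W \<Longrightarrow> pair (act \<iota> u) v = pair u v"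
  by (simp add: pair_def adjoint act_act \<iota>J_\<nu>)

lemma pair_act_right: "pair u (act \<iota> v) = pair u v"
  by (simp add: pair_def act_act \<nu>_\<iota>)

text \<open>The element \<open>\<nu> * \<mu> = \<iota>J\<close> moves to the left argument as
  \<open>\<iota>\<close>, which fixes \<open>u\<close>. Thus every value of \<open>\<beta> u\<close>
  is also a value of \<open>pair u\<close>.\<close>

lemma pair_act_mu: "u \<in> I \<Longrightarrow> v \<in> W \<Longrightarrow> pair u (act \<mu> v) = \<beta> u v"
  using adjoint[of u v] by (simp add: pair_def act_act \<nu>\<mu> I_iff)

text \<open>By \<open>pair_act_left\<close>, vanishing against \<open>I\<close> extends to all of
  \<open>W\<close>, so nondegeneracy kills \<open>act \<nu> w\<close>. Acting with
  \<open>\<mu>\<close> then gives \<open>w = act \<iota> w = 0\<close>.\<close>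

lemma pair_nondegenerate_right:
  assumes "w \<in> I" "\<forall>v\<in>I. pair v w = 0"
  shows "w = 0"
proof -
  have w: "w \<in> W" "act \<iota> w = w"
    using assms(1) by (simp_all add: I_iff)
  have "\<forall>v\<in>W. \<beta> v (act \<nu> w) = 0"
    using assms(2) pair_act_left w(1) by (auto simp: pair_def)
  then have "act \<nu> w = 0"
    using nondegenerate w(1) by (auto simp: nondegenerate_on_def)
  then have "act (\<mu> * \<nu>) w = 0"
    by (simp flip: act_act)
  with w(2) show ?thesis
    by (simp add: \<mu>\<nu>)
qed

lemma pair_nondegenerate_left:
  assumes "v \<in> I" "\<forall>w\<in>I. pair v w = 0"
  shows "v = 0"
proof -
  have "\<beta> v x = 0" if "x \<in> W" for x
    using assms that pair_act_mu[OF assms(1) that] pair_act_right[of v "act \<mu> x"] by auto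
  moreover have "v \<in> W"
    using assms(1) by (simp add: I_iff)
  ultimately show ?thesis
    using nondegenerate by (auto simp: nondegenerate_on_def)
qed

lemma sum_pair_left:
  assumes "w \<in> I"
  shows "(\<Sum>v\<in>I. qz_exp (pair v w)) = (if w = 0 then of_nat (card I) else 0)"
proof -
  have "(\<Sum>v\<in>I. qz_exp (pair v w)) = (if \<forall>v\<in>I. pair v w = 0 then of_nat (card I) else 0)"
    by (rule sum_qz_exp[OF finite_I add_I]) (use assms in \<open>auto simp: I_iff pair_add_left\<close>)
  moreover have "pair v 0 = 0" if "v \<in> I" for v
    using pair_add_right[of v 0 0] that zero_W by (simp add: I_iff)
  ultimately show ?thesis
    using pair_nondegenerate_right[OF assms] by auto
qed

lemma sum_pair_right:
  assumes "v \<in> I"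
  shows "(\<Sum>w\<in>I. qz_exp (pair v w)) = (if v = 0 then of_nat (card I) else 0)"
proof -
  have "(\<Sum>w\<in>I. qz_exp (pair v w)) = (if \<forall>w\<in>I. pair v w = 0 then of_nat (card I) else 0)"
    by (rule sum_qz_exp[OF finite_I add_I]) (use assms in \<open>auto simp: I_iff pair_add_right\<close>)
  moreover have "pair 0 w = 0" if "w \<in> I" for w
    using pair_add_left[of 0 0 w] that zero_W by (simp add: I_iff)
  ultimately show ?thesis
    using pair_nondegenerate_left[OF assms] by auto
qed

text \<open>The matrix of \<open>op_h\<close>, kept in the same shape so that the two agree by
  unfolding; \<open>fourier_eq\<close> gives the closed form.\<close>

definition fourier :: "'w \<Rightarrow> 'w \<Rightarrow> complex" where
  "fourier u w = scale * (\<Sum>v\<in>I. qz_exp (\<beta> v (act \<nu> u)) * basis_vec (act (1 - \<iota>) u + v) w)"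

section \<open>Decomposition along \<open>\<iota>\<close> and invertibility of the transform\<close>

lemma split: "act (1 - \<iota>) u + act \<iota> u = u"
  by (simp add: act_diff_left act_one)

lemma split_iff:
  assumes "v \<in> I"
  shows "w = act (1 - \<iota>) u + v \<longleftrightarrow> act (1 - \<iota>) w = act (1 - \<iota>) u \<and> v = act \<iota> w"
proof
  have v: "act \<iota> v = v"
    using assms by (simp add: I_iff)
  assume "w = act (1 - \<iota>) u + v"
  then show "act (1 - \<iota>) w = act (1 - \<iota>) u \<and> v = act \<iota> w"
    by (simp add: act_add_right act_diff_right act_diff_left act_act act_one idem left_diff_distrib
        right_diff_distrib v)
next
  assume "act (1 - \<iota>) w = act (1 - \<iota>) u \<and> v = act \<iota> w"
  then show "w = act (1 - \<iota>) u + v"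
    by (metis split)
qed

lemma fourier_outside: "u \<in> W \<Longrightarrow> w \<notin> W \<Longrightarrow> fourier u w = 0"
  unfolding fourier_def basis_vec_def
  by (auto intro!: sum.neutral add_W)

text \<open>At most one summand contributes to the coefficient at \<open>w\<close>, namely
  \<open>v = act \<iota> w\<close>.\<close>

lemma fourier_eq:
  assumes "u \<in> W" "w \<in> W"
  shows "fourier u w =
    (if act (1 - \<iota>) w = act (1 - \<iota>) u then scale * qz_exp (pair w u) else 0)"
proof -
  let ?P = "act (1 - \<iota>) w = act (1 - \<iota>) u"
  have "(\<Sum>v\<in>I. qz_exp (\<beta> v (act \<nu> u)) * basis_vec (act (1 - \<iota>) u + v) w)
      = (\<Sum>v\<in>I. if v = act \<iota> w then (if ?P then qz_exp (pair v u) else 0) else 0)"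
    by (rule sum.cong[OF refl]) (auto simp: basis_vec_def split_iff pair_def)
  also have "\<dots> = (if ?P then qz_exp (pair (act \<iota> w) u) else 0)"
    using finite_I assms(2) by simp
  finally show ?thesis
    using assms by (simp add: fourier_def pair_act_left)
qed

lemma sum_fibre:
  assumes S: "is_submodule S" "S \<subseteq> W" and "u \<in> S"
  shows "(\<Sum>w\<in>S. if act (1 - \<iota>) w = act (1 - \<iota>) u then f (act \<iota> w) else 0)
    = (\<Sum>z\<in>act \<iota> ` S. f z)"
proof -
  have fin: "finite S"
    using S(2) finite_W finite_subset by blast
  have "(\<Sum>w\<in>{w \<in> S. act (1 - \<iota>) w = act (1 - \<iota>) u}. f (act \<iota> w)) = (\<Sum>z\<in>act \<iota> ` S. f z)"
  proof (rule sum.reindex_bij_witness[where i = "\<lambda>z. act (1 - \<iota>) u + z" and j = "act \<iota>"])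
    fix w
    assume "w \<in> {w \<in> S. act (1 - \<iota>) w = act (1 - \<iota>) u}"
    then show "act (1 - \<iota>) u + act \<iota> w = w" "act \<iota> w \<in> act \<iota> ` S" "f (act \<iota> w) = f (act \<iota> w)"
      using split[of w] by auto
  next
    fix z
    assume z: "z \<in> act \<iota> ` S"
    then have "z \<in> I"
      using S(2) by blast
    then show "act \<iota> (act (1 - \<iota>) u + z) = z"
      using split_iff[of z "act (1 - \<iota>) u + z" u] by simp
    show "act (1 - \<iota>) u + z \<in> {w \<in> S. act (1 - \<iota>) w = act (1 - \<iota>) u}"
      using split_iff[OF \<open>z \<in> I\<close>, of "act (1 - \<iota>) u + z" u] z assms(3) S(1)
      by (auto intro!: submodule_add submodule_act)
  qed
  then show ?thesis
    using fin by (simp add: sum.inter_filter)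
qed

lemma eq_iff_components: "u = x \<longleftrightarrow> act (1 - \<iota>) u = act (1 - \<iota>) x \<and> act \<iota> (u - x) = 0"
  by (metis act_diff_right eq_iff_diff_eq_0 split)

lemma fourier_in_GL: "linear_extension W fourier \<in> carrier (GL W)"
proof -
  \<comment> \<open>The conjugate transpose of \<open>fourier\<close> on \<open>W\<close>: arguments
    exchanged and character negated. The transform is thus unitary.\<close>
  define E' where "E' u w = (if w \<in> W \<and> act (1 - \<iota>) w = act (1 - \<iota>) u
    then scale * qz_exp (- pair u w) else 0)" for u w
  show ?thesis
  proof (rule linear_extension_in_GL[where E' = E'])
    fix u x
    assume u: "u \<in> W" and x: "x \<in> W"
    let ?P = "act (1 - \<iota>) u = act (1 - \<iota>) x"
    have ux: "u - x \<in> W" "x - u \<in> W"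
      using u x by (simp_all add: diff_W)
    \<comment> \<open>The exponents combine to \<open>pair w (u - x)\<close>, which leaves a
      character sum over \<open>I\<close> in the first argument of \<open>pair\<close>.\<close>
    have "(\<Sum>w\<in>W. fourier u w * E' w x) = (\<Sum>w\<in>W. if act (1 - \<iota>) w = act (1 - \<iota>) u then
        (if ?P then scale * scale * qz_exp (pair (act \<iota> w) (act \<iota> (u - x))) else 0) else 0)"
      by (rule sum.cong[OF refl])
        (use u x ux in \<open>auto simp: fourier_eq E'_def pair_act_left pair_act_right pair_diff_right
          qz_exp_diff\<close>)
    also have "\<dots> = (\<Sum>z\<in>I. if ?P then scale * scale * qz_exp (pair z (act \<iota> (u - x))) else 0)"
      by (rule sum_fibre[OF submodule_W subset_refl u])
    also have "\<dots> = (if ?P then scale * scale * (\<Sum>z\<in>I. qz_exp (pair z (act \<iota> (u - x)))) else 0)"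
      by (simp flip: sum_distrib_left)
    also have "\<dots> = (if ?P \<and> act \<iota> (u - x) = 0 then 1 else 0)"
      by (subst sum_pair_left) (use ux scale_sq in auto)
    also have "?P \<and> act \<iota> (u - x) = 0 \<longleftrightarrow> u = x"
      using eq_iff_components[of u x] by auto
    finally show "(\<Sum>w\<in>W. fourier u w * E' w x) = (if u = x then 1 else 0)" .
    \<comment> \<open>In this order the summation variable sits in the second argument, so
      nondegeneracy on the other side is used.\<close>
    have "(\<Sum>w\<in>W. E' u w * fourier w x) = (\<Sum>w\<in>W. if act (1 - \<iota>) w = act (1 - \<iota>) u then
        (if ?P then scale * scale * qz_exp (pair (act \<iota> (x - u)) (act \<iota> w)) else 0) else 0)"
      by (rule sum.cong[OF refl])
        (use u x ux in \<open>auto simp: fourier_eq E'_def pair_act_left pair_act_right pair_diff_left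
          qz_exp_diff\<close>)
    also have "\<dots> = (\<Sum>z\<in>I. if ?P then scale * scale * qz_exp (pair (act \<iota> (x - u)) z) else 0)"
      by (rule sum_fibre[OF submodule_W subset_refl u])
    also have "\<dots> = (if ?P then scale * scale * (\<Sum>z\<in>I. qz_exp (pair (act \<iota> (x - u)) z)) else 0)"
      by (simp flip: sum_distrib_left)
    also have "\<dots> = (if ?P \<and> act \<iota> (x - u) = 0 then 1 else 0)"
      by (subst sum_pair_right) (use ux scale_sq in auto)
    also have "?P \<and> act \<iota> (x - u) = 0 \<longleftrightarrow> u = x"
      using eq_iff_components[of x u] by auto
    finally show "(\<Sum>w\<in>W. E' u w * fourier w x) = (if u = x then 1 else 0)" .
  qed (auto simp: finite_W fourier_outside E'_def)
qed

section \<open>Self-dual submodules and their weight enumerators\<close>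

context
  fixes D
  assumes submodule_D: "is_submodule D"
    and self_dual: "D = {v \<in> W. \<forall>u\<in>D. \<beta> v u = 0}"
begin

lemma D_subset: "D \<subseteq> W"
  using self_dual by blast

text \<open>\<open>D\<close> is closed under \<open>\<mu>\<close> and \<open>\<nu>\<close>, so
  orthogonality can be carried between the two forms: \<open>\<beta> (act \<iota> w) d\<close> is
  the pairing of \<open>w\<close> with \<open>act \<mu> d\<close>, and \<open>pair w d\<close> is
  \<open>\<beta> (act \<iota> w) (act \<nu> d)\<close>. Self-duality turns orthogonality into
  membership.\<close>

lemma orthogonal_iff:
  assumes "w \<in> W"
  shows "(\<forall>z\<in>act \<iota> ` D. pair w z = 0) \<longleftrightarrow> act \<iota> w \<in> D"
proof
  assume orth: "\<forall>z\<in>act \<iota> ` D. pair w z = 0"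
  have "\<beta> (act \<iota> w) d = 0" if d: "d \<in> D" for d
  proof -
    have "act \<mu> d \<in> D" "d \<in> W"
      using d D_subset submodule_act[OF submodule_D] by auto
    then have "\<beta> (act \<iota> w) d = pair w (act \<iota> (act \<mu> d))"
      using assms by (simp add: pair_act_right pair_act_left flip: pair_act_mu)
    with orth \<open>act \<mu> d \<in> D\<close> show ?thesis
      by simp
  qed
  with assms show "act \<iota> w \<in> D"
    by (subst self_dual) simp
next
  assume "act \<iota> w \<in> D"
  then have "\<beta> (act \<iota> w) d = 0" if "d \<in> D" for d
    using that self_dual by blast
  then have "pair w d = 0" if "d \<in> D" for d
    using that assms submodule_act[OF submodule_D] D_subset pair_act_left[of w d]
    by (auto simp: pair_def)
  then show "\<forall>z\<in>act \<iota> ` D. pair w z = 0"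
    by (auto simp: pair_act_right)
qed

lemma sum_pair_D:
  assumes "w \<in> W"
  shows "(\<Sum>z\<in>act \<iota> ` D. qz_exp (pair w z))
    = (if act \<iota> w \<in> D then of_nat (card (act \<iota> ` D)) else 0)"
proof -
  have "finite (act \<iota> ` D)"
    using D_subset finite_W finite_subset by blast
  moreover have "x + y \<in> act \<iota> ` D" if "x \<in> act \<iota> ` D" "y \<in> act \<iota> ` D" for x y
    using that submodule_add[OF submodule_D] by (auto simp flip: act_add_right)
  moreover have "pair w (x + y) = pair w x + pair w y" if "x \<in> act \<iota> ` D" "y \<in> act \<iota> ` D" for x y
    by (rule pair_add_right) (use that D_subset assms in auto)
  ultimately have "(\<Sum>z\<in>act \<iota> ` D. qz_exp (pair w z))
      = (if \<forall>z\<in>act \<iota> ` D. pair w z = 0 then of_nat (card (act \<iota> ` D)) else 0)"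
    by (rule sum_qz_exp)
  then show ?thesis
    by (simp only: orthogonal_iff[OF assms])
qed

text \<open>Double counting of the character sum over \<open>I\<close> and
  \<open>act \<iota>\<close>
  D\<open>. Summing over the second variable first leaves the\<close>v\<open>in\<close>D\<open>, each contributing\<close>card
  (act \<iota> \<open>D)\<close>; summing over the first leaves only \<open>z = 0\<close>,
  contributing \<open>card I\<close>.\<close>

lemma card_I: "card I = (card (act \<iota> ` D))\<^sup>2"
proof -
  let ?K = "act \<iota> ` D"
  have K: "{v \<in> I. v \<in> D} = ?K"
    using D_subset submodule_act[OF submodule_D] by (auto simp: I_iff act_act idem) (metis imageI)
  have KI: "?K \<subseteq> I"
    using D_subset by blast
  have fin: "finite ?K"
    using KI finite_I finite_subset by blast
  have zero: "0 \<in> ?K"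
    using submodule_zero[OF submodule_D] by force
  have "(\<Sum>v\<in>I. \<Sum>z\<in>?K. qz_exp (pair v z)) = (\<Sum>v\<in>I. if v \<in> D then of_nat (card ?K) else 0)"
    by (rule sum.cong[OF refl]) (simp only: I_iff sum_pair_D)
  also have "\<dots> = (\<Sum>v\<in>{v \<in> I. v \<in> D}. of_nat (card ?K))"
    using finite_I by (simp only: sum.inter_filter)
  also have "\<dots> = of_nat ((card ?K)\<^sup>2)"
    unfolding K by (simp add: power2_eq_square)
  finally have "complex_of_nat ((card ?K)\<^sup>2) = (\<Sum>v\<in>I. \<Sum>z\<in>?K. qz_exp (pair v z))" ..
  also have "\<dots> = (\<Sum>z\<in>?K. \<Sum>v\<in>I. qz_exp (pair v z))"
    by (rule sum.swap)
  also have "\<dots> = (\<Sum>z\<in>?K. if z = 0 then of_nat (card I) else 0)"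
    by (rule sum.cong[OF refl]) (use KI sum_pair_left in blast)
  also have "\<dots> = of_nat (card I)"
    using fin zero by simp
  finally show ?thesis
    by (simp only: of_nat_eq_iff)
qed

lemma scale_card: "scale * of_nat (card (act \<iota> ` D)) = 1"
proof -
  let ?k = "real (card (act \<iota> ` D))"
  have "card I > 0"
    using finite_I zero_W by (auto simp: card_gt_0_iff)
  then have k: "?k > 0"
    by (simp add: card_I)
  have "real (card I) = ?k powr 2"
    using k by (simp add: card_I powr_numeral)
  then have "real (card I) powr (- 1 / 2) * ?k = 1"
    using k by (simp add: powr_powr powr_minus)
  then show ?thesis
    unfolding scale_def by (metis of_real_1 of_real_mult of_real_of_nat_eq)
qed

lemma fourier_fixes:
  "linear_extension W fourier (full_weight_enumerator D) = full_weight_enumerator D"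
proof -
  have "(\<Sum>u\<in>D. fourier u w) = (if w \<in> D then 1 else 0)" for w
  proof (cases "\<exists>u0\<in>D. w \<in> W \<and> act (1 - \<iota>) w = act (1 - \<iota>) u0")
    case True
    then obtain u0 where u0: "u0 \<in> D" and w: "w \<in> W" "act (1 - \<iota>) w = act (1 - \<iota>) u0"
      by blast
    have "(\<Sum>u\<in>D. fourier u w) = (\<Sum>u\<in>D. if act (1 - \<iota>) u = act (1 - \<iota>) u0
        then scale * qz_exp (pair w (act \<iota> u)) else 0)"
      by (rule sum.cong[OF refl]) (use w D_subset in \<open>auto simp: fourier_eq pair_act_right\<close>)
    also have "\<dots> = (\<Sum>z\<in>act \<iota> ` D. scale * qz_exp (pair w z))"
      by (rule sum_fibre[OF submodule_D D_subset u0])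
    also have "\<dots> = (if act \<iota> w \<in> D then 1 else 0)"
      using w(1) by (simp add: sum_pair_D scale_card flip: sum_distrib_left)
    \<comment> \<open>The other component of \<open>w\<close> is that of \<open>u0\<close>, hence
      already in \<open>D\<close>.\<close>
    also have "act \<iota> w \<in> D \<longleftrightarrow> w \<in> D"
      using split[of w] w(2) submodule_act[OF submodule_D] u0 submodule_add[OF submodule_D]
      by metis
    finally show ?thesis .
  next
    case False
    then have "fourier u w = 0" if "u \<in> D" for u
      using that D_subset fourier_outside[of u w] fourier_eq[of u w] by auto
    moreover have "w \<notin> D"
      using False D_subset by blast
    ultimately show ?thesis
      by simp
  qed
  moreover have "finite D"
    using D_subset finite_W finite_subset by blast
  ultimately show ?thesis
    by (subst linear_extension_full_weight_enumerator[OF finite_W D_subset])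
      (simp add: full_weight_enumerator_eq)
qed

end

end


section \<open>Symmetric idempotents\<close>

context twisted_ring
begin

lemma psi_J_map: "\<psi> (J_map mact \<psi> r) = mact (\<psi> 1) r 1"
  using \<psi>_bij by (simp add: J_map_def bij_is_surj surj_f_inv_f)

lemma psi_eq: "\<psi> r = mact (\<psi> 1) 1 r"
  using \<psi>_mult[of 1 r] by simp

text \<open>The two tensor slots act independently, so left factors can be exchanged for right ones
  through \<open>\<psi>\<close>, which reverses products. The purpose is that J maps idempotents to
  idempotents.\<close>

lemma J_map_mult: "J_map mact \<psi> (r * s) = J_map mact \<psi> s * J_map mact \<psi> r"
proof -
  have "\<psi> (J_map mact \<psi> (r * s)) = mact (\<psi> (J_map mact \<psi> r)) s 1"
    by (simp add: psi_J_map mact_mact)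
  also have "\<dots> = mact (mact (\<psi> 1) s 1) 1 (J_map mact \<psi> r)"
    unfolding psi_eq[of "J_map mact \<psi> r"] by (simp add: mact_mact)
  also have "\<dots> = mact (\<psi> (J_map mact \<psi> s)) 1 (J_map mact \<psi> r)"
    by (simp add: psi_J_map)
  also have "\<dots> = \<psi> (J_map mact \<psi> s * J_map mact \<psi> r)"
    by (simp add: \<psi>_mult)
  finally show ?thesis
    using \<psi>_bij by (simp add: bij_is_inj inj_eq)
qed

end

text \<open>Left multiplication by \<open>\<nu>\<close> is injective on the right ideal of
  \<open>\<iota>\<close>, with \<open>\<mu>\<close> as left inverse. The isomorphism supplies equal
  cardinalities, so by finiteness the map is onto the right ideal of \<open>\<kappa>\<close>;
  writing \<open>\<kappa> = \<nu> * x\<close> then determines \<open>\<nu> * \<mu>\<close>.\<close>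

lemma factorization_commute:
  fixes \<iota> \<kappa> \<mu> \<nu> :: "'r::{ring_1, finite}"
  assumes iso: "right_ideals_isomorphic \<iota> \<kappa>"
    and "\<iota> * \<iota> = \<iota>" "\<kappa> * \<kappa> = \<kappa>"
    and "\<mu> * \<nu> = \<iota>" "\<mu> * \<kappa> = \<mu>" "\<kappa> * \<nu> = \<nu>" "\<nu> * \<iota> = \<nu>"
  shows "\<nu> * \<mu> = \<kappa>"
proof -
  let ?A = "range ((*) \<iota>)" and ?B = "range ((*) \<kappa>)"
  have fixed: "\<iota> * x = x" if "x \<in> ?A" for x
    using that assms(2) by (auto simp flip: mult.assoc)
  have "card ?A = card ?B"
    using iso bij_betw_same_card by (auto simp: right_ideals_isomorphic_def)
  moreover have "inj_on ((*) \<nu>) ?A"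
  proof (rule inj_on_inverseI)
    fix x
    assume "x \<in> ?A"
    then show "\<mu> * (\<nu> * x) = x"
      by (metis assms(4) fixed mult.assoc)
  qed
  moreover have "(*) \<nu> ` ?A \<subseteq> ?B"
    by (metis assms(6) image_subsetI mult.assoc rangeI)
  ultimately have "(*) \<nu> ` ?A = ?B"
    by (intro card_subset_eq) (simp_all add: card_image)
  moreover have "\<kappa> \<in> ?B"
    by (metis mult.right_neutral rangeI)
  ultimately obtain x where x: "x \<in> ?A" "\<kappa> = \<nu> * x"
    by blast
  have "\<nu> * \<mu> = \<nu> * (\<mu> * \<kappa>)"
    by (simp add: assms(5))
  also have "\<dots> = \<nu> * (\<mu> * \<nu> * x)"
    by (simp add: x(2) mult.assoc)
  also have "\<dots> = \<kappa>"
    using fixed[OF x(1)] by (simp add: assms(4) x(2))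
  finally show ?thesis .
qed


section \<open>The space of invariant vectors\<close>

lemma ring_inverse_eq:
  assumes "r * s = 1" "s * r = (1 :: 'r::ring_1)"
  shows "ring_inverse r = s"
  unfolding ring_inverse_def
proof (rule the_equality)
  fix t
  assume "r * t = 1 \<and> t * r = 1"
  then have "t = t * (r * s)"
    by (simp add: assms)
  also have "\<dots> = s"
    using \<open>r * t = 1 \<and> t * r = 1\<close> by (simp flip: mult.assoc)
  finally show "t = s" .
qed (use assms in simp)

text \<open>Inverses of central elements are central. Hence the coefficients of
  \<open>theta G\<close> commute with all scalars, and \<open>theta\<close> is linear over the
  ring.\<close>

lemma ring_inverse_of_nat_commute:
  assumes "ring_unit (of_nat n :: 'r::ring_1)"
  shows "ring_inverse (of_nat n) * r = r * (ring_inverse (of_nat n) :: 'r)"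
proof -
  obtain s :: 'r where s: "of_nat n * s = 1" "s * of_nat n = 1"
    using assms by (auto simp: ring_unit_def)
  have "s * r = s * (r * (of_nat n * s))"
    by (simp add: s)
  also have "\<dots> = s * of_nat n * r * s"
    by (metis mult.assoc mult_of_nat_commute)
  finally show ?thesis
    by (simp add: ring_inverse_eq[OF s] s)
qed

context left_module
begin

lemma group_ring_act_add:
  "group_ring_act act G a (u + v) = group_ring_act act G a u + group_ring_act act G a v"
  by (simp add: group_ring_act_def vec_eq_iff vec_act_def perm_act_def act_add_right
      sum.distrib)

lemma group_ring_act_zero: "group_ring_act act G a 0 = 0"
  using group_ring_act_add[of G a 0 0] by simp

lemma vec_act_group_ring_act:
  assumes "\<And>g. g \<in> G \<Longrightarrow> r * a g = a g * r"
  shows "vec_act act r (group_ring_act act G a v) = group_ring_act act G a (vec_act act r v)"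
  using assms
  by (simp add: group_ring_act_def vec_eq_iff vec_act_def perm_act_def act_sum act_act)

end

lemma is_submodule_theta_image:
  assumes "left_module (act :: 'r::ring_1 \<Rightarrow> 'v::ab_group_add \<Rightarrow> 'v)"
    and unit: "ring_unit (of_nat (card G) :: 'r)"
    and C: "left_module.is_submodule (vec_act act) (C :: ('v ^ 'n) set)"
  shows "left_module.is_submodule (vec_act act) (theta_image act G C)"
proof -
  interpret left_module act by fact
  interpret vec: left_module "vec_act act :: 'r \<Rightarrow> 'v ^ 'n \<Rightarrow> 'v ^ 'n"
    by (rule left_module_vec_act) fact
  have comm: "vec_act act r (group_ring_act act G (theta G) u)
      = group_ring_act act G (theta G) (vec_act act r u)" for r and u :: "'v ^ 'n"
    by (rule vec_act_group_ring_act) (simp add: theta_def ring_inverse_of_nat_commute[OF unit])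
  show ?thesis
    unfolding vec.is_submodule_def theta_image_def
    using vec.submodule_zero[OF C] vec.submodule_add[OF C] vec.submodule_act[OF C]
    by (force simp: comm group_ring_act_zero simp flip: group_ring_act_add)
qed

lemma is_submodule_G_code:
  fixes G :: "('n::finite \<Rightarrow> 'n) set"
  assumes "left_module act" and "id \<in> G" and C: "G_code act G C"
  shows "left_module.is_submodule (vec_act act) C"
proof -
  interpret left_module act by fact
  interpret vec: left_module "vec_act act :: 'a \<Rightarrow> 'b ^ 'n \<Rightarrow> 'b ^ 'n"
    by (rule left_module_vec_act) fact
  \<comment> \<open>Scalars embed in the group ring as multiples of the identity
    permutation.\<close>
  have "group_ring_act act G (\<lambda>g. if g = id then r else 0) u = vec_act act r u" for r u
  proof -
    have "perm_act id u = u"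
      by (simp add: perm_act_def vec_eq_iff)
    then have "vec_act act (if g = id then r else 0) (perm_act g u)
        = (if g = id then vec_act act r u else 0)" for g
      by simp
    then show ?thesis
      using assms(2) by (simp add: group_ring_act_def)
  qed
  then show ?thesis
    using C unfolding vec.is_submodule_def G_code_def by metis
qed

lemma bil_G_add:
  fixes act :: "'r::ring_1 \<Rightarrow> 'v::ab_group_add \<Rightarrow> 'v" and G :: "('n::finite \<Rightarrow> 'n) set"
  assumes "left_module.is_submodule (vec_act act) (theta_space act G)" "left_module act"
    and "b \<in> Bil_G act G A"
    and "u \<in> theta_space act G" "v \<in> theta_space act G" "w \<in> theta_space act G"
  shows "b (u + v) w = b u w + b v w" "b u (v + w) = b u v + b u w"
proof -
  interpret vec: left_module "vec_act act :: 'r \<Rightarrow> 'v ^ 'n \<Rightarrow> 'v ^ 'n"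
    by (rule left_module_vec_act) fact
  obtain b' where b': "b = bil_G act G A b'" "b' \<in> Bil"
    using assms(3) by (auto simp: Bil_G_def)
  show "b (u + v) w = b u w + b v w" "b u (v + w) = b u v + b u w"
    using b'(2) assms(4-6) vec.submodule_add[OF assms(1)]
    by (simp_all add: b'(1) bil_G_def Bil_def additive_def sum.distrib)
qed


section \<open>Invariance under the Clifford-Weil group\<close>

lemma partial_fourier_of_factorization:
  fixes act :: "'r::{ring_1, finite} \<Rightarrow> 'v::{ab_group_add, finite} \<Rightarrow> 'v"
    and G :: "('n::finite \<Rightarrow> 'n) set"
  assumes "left_module act" and "ring_unit (of_nat (card G) :: 'r)"
    and "twisted_ring mact \<tau> \<psi>"
    and rep: "G_representation act G A mact \<tau> \<psi> qact br lam \<rho>M \<rho>\<Phi> \<beta>"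
    and fact: "symmetric_idempotent_factorization mact \<psi> \<iota> \<mu> \<nu>"
  shows "partial_fourier (vec_act act) (theta_space act G) \<beta> \<iota> (J_map mact \<psi> \<iota>) \<mu> \<nu>"
proof -
  interpret twisted_ring mact \<tau> \<psi> by fact
  interpret vec: left_module "vec_act act :: 'r \<Rightarrow> 'v ^ 'n \<Rightarrow> 'v ^ 'n"
    by (rule left_module_vec_act) fact
  let ?W = "theta_space act G" and ?J = "J_map mact \<psi>"
  have W: "vec.is_submodule ?W"
    by (rule is_submodule_theta_image[OF assms(1,2)]) (simp add: vec.is_submodule_def)
  have idem: "\<iota> * \<iota> = \<iota>" and iso: "right_ideals_isomorphic \<iota> (?J \<iota>)" and \<mu>\<nu>: "\<iota> = \<mu> * \<nu>"
    using fact unfolding symmetric_idempotent_factorization_def symmetric_idempotent_def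
    by blast+
  have idemJ: "?J \<iota> * ?J \<iota> = ?J \<iota>"
    using J_map_mult[of \<iota> \<iota>] by (simp add: idem)
  obtain a b where "\<mu> = \<iota> * a * ?J \<iota>" "\<nu> = ?J \<iota> * b * \<iota>"
    using fact unfolding symmetric_idempotent_factorization_def by blast
  then have factors: "\<mu> * ?J \<iota> = \<mu>" "?J \<iota> * \<nu> = \<nu>" "\<nu> * \<iota> = \<nu>"
    by (simp_all add: mult.assoc idem idemJ) (simp_all add: idemJ flip: mult.assoc)
  have \<beta>: "\<beta> = \<rho>M (\<psi> 1)" "\<beta> \<in> Bil_G act G A" "nondegenerate_on ?W \<beta>"
    and mact: "\<And>m r s u v. u \<in> ?W \<Longrightarrow> v \<in> ?W \<Longrightarrow>
      \<rho>M (mact m r s) u v = \<rho>M m (vec_act act r u) (vec_act act s v)"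
    using rep by (auto simp: G_representation_def Let_def)
  show ?thesis
  proof unfold_locales
    fix u v
    assume uv: "u \<in> ?W" "v \<in> ?W"
    \<comment> \<open>Both sides are values of the form attached to
      \<open>\<psi> (?J \<iota>)\<close>, read once with \<open>\<iota>\<close> in the left slot and
      once with \<open>?J \<iota>\<close> in the right slot.\<close>
    have "\<beta> (vec_act act \<iota> u) v = \<rho>M (\<psi> (?J \<iota>)) u v"
      using uv by (simp add: psi_J_map mact \<beta>(1) vec.act_one)
    also have "\<dots> = \<beta> u (vec_act act (?J \<iota>) v)"
      using uv by (simp add: psi_eq[of "?J \<iota>"] mact \<beta>(1) vec.act_one)
    finally show "\<beta> (vec_act act \<iota> u) v = \<beta> u (vec_act act (?J \<iota>) v)" .
  qed (use W \<beta> idem factors \<mu>\<nu>[symmetric] bil_G_add[OF W assms(1) \<beta>(2)]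
      factorization_commute[OF iso idem idemJ \<mu>\<nu>[symmetric] factors] in auto)
qed

theorem theorem1p4:
  fixes act :: "'r::{ring_1, finite} \<Rightarrow> 'v::{ab_group_add, finite} \<Rightarrow> 'v"
    and G :: "('n::finite \<Rightarrow> 'n) set"
    and A :: "'n set"
    and mact :: "'m::ab_group_add \<Rightarrow> 'r \<Rightarrow> 'r \<Rightarrow> 'm"
    and \<tau> :: "'m \<Rightarrow> 'm"
    and \<psi> :: "'r \<Rightarrow> 'm"
    and qact :: "'f::ab_group_add \<Rightarrow> 'r \<Rightarrow> 'f"
    and br :: "'m \<Rightarrow> 'f"
    and lam :: "'f \<Rightarrow> 'm"
    and \<rho>M :: "'m \<Rightarrow> 'v ^ 'n \<Rightarrow> 'v ^ 'n \<Rightarrow> qz"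
    and \<rho>\<Phi> :: "'f \<Rightarrow> 'v ^ 'n \<Rightarrow> qz"
    and \<beta> :: "'v ^ 'n \<Rightarrow> 'v ^ 'n \<Rightarrow> qz"
    and C :: "('v ^ 'n) set"
  assumes "left_module act"
    and "subgroup G (BijGroup (UNIV :: 'n set))"
    and "ring_unit (of_nat (card G) :: 'r)"
    and "orbit_representatives G A"
    and "form_ring mact \<tau> \<psi> qact br lam"
    and "G_representation act G A mact \<tau> \<psi> qact br lam \<rho>M \<rho>\<Phi> \<beta>"
    and "G_code act G C"
    and "G_self_dual act G \<beta> C"
    and "G_isotropic act G \<rho>M \<rho>\<Phi> C"
  shows "\<forall>T \<in> Clifford_Weil_group act G mact \<psi> \<rho>\<Phi> \<beta>.
           T (full_weight_enumerator (theta_image act G C))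
             = full_weight_enumerator (theta_image act G C)"
proof -
  interpret vec: left_module "vec_act act :: 'r \<Rightarrow> 'v ^ 'n \<Rightarrow> 'v ^ 'n"
    by (rule left_module_vec_act) fact
  interpret form_ring mact \<tau> \<psi> qact br lam by fact
  let ?W = "theta_space act G" and ?D = "theta_image act G C"
  \<comment> \<open>The neutral element of \<open>BijGroup UNIV\<close> is the identity restricted
    to \<open>UNIV\<close>, that is, \<open>id\<close>.\<close>
  have "id \<in> G"
    using subgroup.one_closed[OF assms(2)] by (simp add: BijGroup_def id_def restrict_def)
  then have D: "vec.is_submodule ?D"
    by (intro is_submodule_theta_image is_submodule_G_code[OF _ _ assms(7)] assms(1,3))
  have W: "vec.is_submodule ?W"
    by (rule is_submodule_theta_image[OF assms(1,3)]) (simp add: vec.is_submodule_def)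
  have DW: "?D \<subseteq> ?W"
    by (auto simp: theta_image_def)
  have fin: "finite ?W"
    by simp
  let ?H = "{op_m act G r | r. ring_unit r} \<union> {op_d act G \<rho>\<Phi> \<phi> | \<phi>. True} \<union>
    {op_h act G \<beta> \<iota> \<nu> | \<iota> \<mu> \<nu>. symmetric_idempotent_factorization mact \<psi> \<iota> \<mu> \<nu>}"
  let ?f = "full_weight_enumerator ?D"
  have m: "op_m act G r \<in> carrier (GL ?W)" "op_m act G r ?f = ?f" if "ring_unit r" for r
    using multiplication_in_GL[OF vec.left_module_axioms W fin that]
      multiplication_fixes[OF vec.left_module_axioms D fin DW that]
    by (simp_all add: op_m_def)
  have isotropic: "\<rho>\<Phi> \<phi> u = 0" if "u \<in> ?D" for \<phi> u
    using assms(9) that by (simp add: G_isotropic_def)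
  have d: "op_d act G \<rho>\<Phi> \<phi> \<in> carrier (GL ?W)" "op_d act G \<rho>\<Phi> \<phi> ?f = ?f" for \<phi>
    using diagonal_in_GL[OF fin, of "\<rho>\<Phi> \<phi>"] diagonal_fixes[OF fin DW, of "\<rho>\<Phi> \<phi>"] isotropic
    by (simp_all add: op_d_def)
  have h: "op_h act G \<beta> \<iota> \<nu> \<in> carrier (GL ?W)" "op_h act G \<beta> \<iota> \<nu> ?f = ?f"
    if "symmetric_idempotent_factorization mact \<psi> \<iota> \<mu> \<nu>" for \<iota> \<mu> \<nu>
  proof -
    interpret partial_fourier "vec_act act" ?W \<beta> \<iota> "J_map mact \<psi> \<iota>" \<mu> \<nu>
      by (rule partial_fourier_of_factorization[OF assms(1,3) twisted_ring_axioms assms(6) that])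
    have "op_h act G \<beta> \<iota> \<nu> = linear_extension ?W fourier"
      unfolding op_h_def Let_def fourier_def[abs_def] scale_def ..
    then show "op_h act G \<beta> \<iota> \<nu> \<in> carrier (GL ?W)" "op_h act G \<beta> \<iota> \<nu> ?f = ?f"
      using fourier_in_GL fourier_fixes[OF D] assms(8) by (simp_all add: G_self_dual_def)
  qed
  have f: "?f \<in> basis_space ?W"
    using DW by (auto simp: full_weight_enumerator_eq basis_space_def)
  \<comment> \<open>It remains to pass from the three families of generators to the group.\<close>
  have "T ?f = ?f" if "T \<in> generate (GL ?W) ?H" for T
    by (rule generate_GL_fixes[OF _ f _ that]) (use m d h in auto)
  then show ?thesis
    by (simp add: Clifford_Weil_group_def)
qed

end
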